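(* Let $\theta,\rho\in\mathbb{R}$ with $|\theta|<1$, $|\rho|<1$, let $(V_n)_{n\ge1}$ be a sequence of square-integrable, independent and identically distributed real random variables with zero mean and variance $\sigma^2>0$, let the initial values $X_0,\varepsilon_0$ be arbitrary, and for all $n\ge1$ let $X_n=\theta X_{n-1}+\varepsilon_n$ and $\varepsilon_n=\rho\varepsilon_{n-1}+V_n$. Let $\widehat{D}_n$ be the Durbin-Watson statistic defined in the context. Then $$\lim_{n\to\infty}\widehat{D}_n=D^*\quad\text{almost surely},\qquad\text{where }D^*=2(1-\rho^* ),\quad \rho^*=\frac{\theta\rho(\theta+\rho)}{1+\theta\rho}.$$
   Context: For $n\ge1$ put $$\widehat{\theta}_n=\frac{\sum_{k=1}^n X_kX_{k-1}}{\sum_{k=1}^n X_{k-1}^2}.$$ At step $n$, the least squares residuals are $\widehat{\varepsilon}_0=X_0$ and $\widehat{\varepsilon}_k=X_k-\widehat{\theta}_nX_{k-1}$ for $1\le k\le n$ (they depend on $n$ through $\widehat\theta_n$). The Durbin-Watson statistic is $$\widehat{D}_n=\frac{\sum_{k=1}^n(\widehat{\varepsilon}_k-\widehat{\varepsilon}_{k-1})^2}{\sum_{k=0}^n\widehat{\varepsilon}_k^{\,2}}.$$ Convention: a quotient defining an estimator or $\widehat D_n$ is read as $0$ if its denominator vanishes. *)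

theory Defs
  imports "HOL-Probability.Probability"
begin

text \<open>
  The statistics below are functions of a single real path \<open>x 0, x 1, x 2, \<dots>\<close>. HOL's
  \<open>a / 0 = 0\<close> is exactly the convention that a quotient with vanishing denominator is read as 0.
\<close>

definition theta_hat :: "(nat \<Rightarrow> real) \<Rightarrow> nat \<Rightarrow> real" where
  "theta_hat x n = (\<Sum>k=1..n. x k * x (k - 1)) / (\<Sum>k=1..n. (x (k - 1))\<^sup>2)"

text \<open>\<open>residual x n k\<close> is the \<open>k\<close>-th least squares residual at step \<open>n\<close>, meant for \<open>k \<le> n\<close>.\<close>

definition residual :: "(nat \<Rightarrow> real) \<Rightarrow> nat \<Rightarrow> nat \<Rightarrow> real" where
  "residual x n k = (if k = 0 then x 0 else x k - theta_hat x n * x (k - 1))"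

definition durbin_watson :: "(nat \<Rightarrow> real) \<Rightarrow> nat \<Rightarrow> real" where
  "durbin_watson x n =
     (\<Sum>k=1..n. (residual x n k - residual x n (k - 1))\<^sup>2) / (\<Sum>k=0..n. (residual x n k)\<^sup>2)"

definition rho_star :: "real \<Rightarrow> real \<Rightarrow> real" where
  "rho_star \<theta> \<rho> = \<theta> * \<rho> * (\<theta> + \<rho>) / (1 + \<theta> * \<rho>)"

definition D_star :: "real \<Rightarrow> real \<Rightarrow> real" where
  "D_star \<theta> \<rho> = 2 * (1 - rho_star \<theta> \<rho>)"

end

theory Submission
  imports Defs "HOL-Library.Discrete_Functions"
begin

text \<open>
  The process satisfies the second order recursion
  \<open>X k = a * X (k - 1) - b * X (k - 2) + V k\<close> with \<open>a = \<theta> + \<rho>\<close> and \<open>b = \<theta> * \<rho>\<close>. If the noise \<open>V k\<close> is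
  asymptotically uncorrelated with the past of the path, then multiplying by \<open>X (k - 1)\<close> and
  \<open>X (k - 2)\<close> and summing gives the Yule-Walker equations for the empirical correlations: at lag one
  they tend to \<open>t = a / (1 + b)\<close> and at lag two to \<open>a * t - b\<close>. The Durbin-Watson statistic is a
  rational function of these correlations and of \<open>theta_hat\<close>, which also tends to \<open>t\<close>, and its limit
  simplifies to \<open>D_star \<theta> \<rho>\<close>.

  Everything is normalised by the energy \<open>S n\<close>, the sum of \<open>(X k)\<^sup>2\<close> over \<open>k \<le> n\<close>, and not by \<open>n\<close>.
  The statistic is a quotient, so this common factor cancels, and a lower bound
  \<open>S n \<ge> const * n\<close> takes the place of a limit of \<open>S n / n\<close>. The probabilistic input is thereby
  reduced to three almost sure properties of the noise: linear growth of the sum of \<open>(V k)\<^sup>2\<close> from below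
  (\<open>sum_of_squares_linear_growth\<close>), \<open>V n = o(sqrt n)\<close>
  (\<open>identically_distributed_sublinear_growth\<close>), and vanishing averages of \<open>V k * V (k - j)\<close> for every
  fixed lag \<open>j\<close> (\<open>lagged_products_average_vanish\<close>). The first and the third follow from a strong law
  for orthogonal variables with bounded second moments (\<open>strong_law_orthogonal\<close>).

  All that follows is a statement about a single path (\<open>durbin_watson_path_limit\<close>). Its main step
  transports the uncorrelatedness through the two first order recursions
  (\<open>lag_sums_vanish_through_autoregression\<close>). Because this step is pathwise, the initial
  values may be arbitrary, even dependent on the noise.
\<close>

section \<open>Stable first order recursions\<close>

lemma abs_mult_le_mean_square: "\<bar>a * b\<bar> \<le> (a\<^sup>2 + b\<^sup>2) / 2" for a b :: real
  using sum_squares_bound[of "\<bar>a\<bar>" "\<bar>b\<bar>"] by (simp add: abs_mult)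

text \<open>
  After the perturbation has dropped below \<open>d\<close>, iterating the recursion leaves at most
  \<open>d / (1 - r)\<close> of accumulated perturbation plus a geometrically vanishing initial value.
\<close>
lemma contraction_recursion_tendsto_zero:
  fixes u z :: "nat \<Rightarrow> real"
  assumes "0 \<le> r" "r < 1" and nonneg: "\<And>n. 0 \<le> u n"
    and rec: "\<And>n. u (Suc n) \<le> r * u n + z n" and z: "z \<longlonglongrightarrow> 0"
  shows "u \<longlonglongrightarrow> 0"
proof (rule LIMSEQ_I)
  fix e :: real assume "0 < e"
  define d where "d = e * (1 - r) / 2"
  have "0 < d" using \<open>0 < e\<close> \<open>r < 1\<close> by (simp add: d_def)
  then obtain N where N: "\<And>n. n \<ge> N \<Longrightarrow> \<bar>z n\<bar> < d"
    using LIMSEQ_D[OF z] by force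
  have bound: "u (N + m) \<le> r ^ m * u N + e / 2" for m
  proof (induction m)
    case 0
    then show ?case using \<open>0 < e\<close> by simp
  next
    case (Suc m)
    have "u (N + Suc m) \<le> r * u (N + m) + d"
      using rec[of "N + m"] N[of "N + m"] by simp
    also have "\<dots> \<le> r * (r ^ m * u N + e / 2) + d"
      using Suc \<open>0 \<le> r\<close> by (intro add_right_mono mult_left_mono)
    also have "\<dots> = r ^ Suc m * u N + e / 2"
      by (simp add: d_def field_simps)
    finally show ?case .
  qed
  have "(\<lambda>m. r ^ m * u N) \<longlonglongrightarrow> 0"
    using assms by (intro tendsto_mult_left_zero LIMSEQ_realpow_zero)
  then obtain K where K: "\<And>m. m \<ge> K \<Longrightarrow> \<bar>r ^ m * u N\<bar> < e / 2"
    using LIMSEQ_D[of _ 0 "e/2"] \<open>0 < e\<close> by force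
  show "\<exists>no. \<forall>n\<ge>no. norm (u n - 0) < e"
  proof (intro exI allI impI)
    fix n assume "n \<ge> N + K"
    then show "norm (u n - 0) < e"
      using bound[of "n - N"] K[of "n - N"] nonneg[of n] by (simp add: le_diff_conv2 abs_le_iff abs_if split: if_splits)
  qed
qed

text \<open>
  Since \<open>sqrt\<close> is increasing, dividing by it turns the recursion for \<open>y\<close> into a contraction
  for \<open>\<bar>y n\<bar> / sqrt n\<close>. The index is shifted by one because division by zero makes this quotient
  0 at \<open>n = 0\<close>, which would lose track of \<open>y 0\<close>.
\<close>
lemma autoregression_sublinear_growth:
  fixes y z :: "nat \<Rightarrow> real"
  assumes "\<bar>r\<bar> < 1" and rec: "\<And>k. k \<ge> 1 \<Longrightarrow> y k = r * y (k - 1) + z k"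
    and z: "(\<lambda>n. z n / sqrt n) \<longlonglongrightarrow> 0"
  shows "(\<lambda>n. y n / sqrt n) \<longlonglongrightarrow> 0"
proof -
  define u where "u n = \<bar>y (Suc n)\<bar> / sqrt (Suc n)" for n
  have "u \<longlonglongrightarrow> 0"
  proof (rule contraction_recursion_tendsto_zero)
    show "0 \<le> \<bar>r\<bar>" "\<bar>r\<bar> < 1" using assms by auto
    show "0 \<le> u n" for n by (simp add: u_def)
    show "u (Suc n) \<le> \<bar>r\<bar> * u n + \<bar>z (n + 2) / sqrt (n + 2)\<bar>" for n
    proof -
      have "\<bar>y (n + 2)\<bar> \<le> \<bar>r\<bar> * \<bar>y (Suc n)\<bar> + \<bar>z (n + 2)\<bar>"
        using rec[of "n + 2"] by (simp flip: abs_mult)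
      then have "u (Suc n) \<le> \<bar>r\<bar> * (\<bar>y (Suc n)\<bar> / sqrt (n + 2)) + \<bar>z (n + 2)\<bar> / sqrt (n + 2)"
        by (simp add: u_def divide_simps algebra_simps)
      also have "\<bar>y (Suc n)\<bar> / sqrt (n + 2) \<le> u n"
        unfolding u_def by (intro divide_left_mono) auto
      finally show ?thesis by (simp add: mult_left_mono)
    qed
    have "(\<lambda>n. \<bar>z n / sqrt n\<bar>) \<longlonglongrightarrow> 0" using z by (rule tendsto_rabs_zero)
    from LIMSEQ_ignore_initial_segment[OF this, of 2]
    show "(\<lambda>n. \<bar>z (n + 2) / sqrt (n + 2)\<bar>) \<longlonglongrightarrow> 0" .
  qed
  then have "(\<lambda>n. \<bar>y (Suc n) / sqrt (Suc n)\<bar>) \<longlonglongrightarrow> 0"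
    by (simp add: u_def[abs_def])
  then have "(\<lambda>n. y (Suc n) / sqrt (Suc n)) \<longlonglongrightarrow> 0"
    by (rule tendsto_rabs_zero_cancel)
  then show ?thesis
    by (rule LIMSEQ_imp_Suc)
qed

text \<open>
  Write \<open>F j n\<close> for the normalised sum with lag \<open>j\<close>. Inserting the recursion for \<open>y (k - j)\<close> gives
  \<open>F j = r * F (j + 1) + o(1)\<close>, hence \<open>F j = r ^ m * F (j + m) + o(1)\<close> for every \<open>m\<close>. The
  Cauchy-Schwarz inequality bounds \<open>F j n\<close> by one constant for all lags at once, so letting first
  \<open>n\<close> and then \<open>m\<close> tend to infinity proves the claim. This pathwise
  argument takes the place of a martingale law of large numbers; unlike that law it admits an initial
  value that depends on the noise.
\<close>
lemma lag_sums_vanish_through_autoregression: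
  fixes v y z N :: "nat \<Rightarrow> real"
  assumes r: "\<bar>r\<bar> < 1" and rec: "\<And>k. k \<ge> 1 \<Longrightarrow> y k = r * y (k - 1) + z k"
    and N: "filterlim N at_top sequentially"
    and v_bound: "\<forall>\<^sub>F n in sequentially. (\<Sum>k=1..n. (v k)\<^sup>2) \<le> C * N n"
    and y_bound: "\<forall>\<^sub>F n in sequentially. (\<Sum>k=1..n. (y k)\<^sup>2) \<le> C * N n"
    and z_lag: "\<And>j. j \<ge> 1 \<Longrightarrow> (\<lambda>n. (\<Sum>k\<in>{j<..n}. v k * z (k - j)) / N n) \<longlonglongrightarrow> 0"
    and "j \<ge> 1"
  shows "(\<lambda>n. (\<Sum>k\<in>{j<..n}. v k * y (k - j)) / N n) \<longlonglongrightarrow> 0"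
proof -
  define F where "F j n = (\<Sum>k\<in>{j<..n}. v k * y (k - j)) / N n" for j n
  \<comment> \<open>Each step discards the term with \<open>y 0\<close>, which is constant in \<open>n\<close> while \<open>N n\<close> diverges.\<close>
  have shift: "(\<lambda>n. F j n - r * F (Suc j) n) \<longlonglongrightarrow> 0" if "j \<ge> 1" for j
  proof -
    have "(\<Sum>k\<in>{j<..n}. v k * y (k - j)) =
        (\<Sum>k\<in>{j<..n}. v k * z (k - j)) + r * (v (Suc j) * y 0 + (\<Sum>k\<in>{Suc j<..n}. v k * y (k - Suc j)))"
      if "n > j" for n
    proof -
      have "(\<Sum>k\<in>{j<..n}. v k * y (k - j))
          = (\<Sum>k\<in>{j<..n}. v k * z (k - j) + r * (v k * y (k - Suc j)))"
      proof (intro sum.cong refl)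
        fix k assume "k \<in> {j<..n}"
        then have "y (k - j) = r * y (k - Suc j) + z (k - j)"
          using rec[of "k - j"] by (simp add: Suc_le_eq)
        then show "v k * y (k - j) = v k * z (k - j) + r * (v k * y (k - Suc j))"
          by (simp add: algebra_simps)
      qed
      also have "\<dots> = (\<Sum>k\<in>{j<..n}. v k * z (k - j)) + r * (\<Sum>k\<in>{j<..n}. v k * y (k - Suc j))"
        by (simp add: sum.distrib sum_distrib_left)
      also have "(\<Sum>k\<in>{j<..n}. v k * y (k - Suc j))
          = v (Suc j) * y 0 + (\<Sum>k\<in>{Suc j<..n}. v k * y (k - Suc j))"
      proof -
        have "{j<..n} = insert (Suc j) {Suc j<..n}"
          using that by auto
        then show ?thesis by simp
      qed
      finally show ?thesis .
    qed
    then have "\<forall>\<^sub>F n in sequentially. (\<Sum>k\<in>{j<..n}. v k * z (k - j)) / N n + r * (v (Suc j) * y 0) / N n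
        = F j n - r * F (Suc j) n"
      by (intro eventually_mono[OF eventually_gt_at_top[of j]])
        (simp add: F_def add_divide_distrib algebra_simps)
    moreover have "(\<lambda>n. (\<Sum>k\<in>{j<..n}. v k * z (k - j)) / N n + r * (v (Suc j) * y 0) / N n) \<longlonglongrightarrow> 0 + 0"
      using that by (intro tendsto_add z_lag tendsto_divide_0[OF tendsto_const]
          filterlim_at_top_imp_at_infinity N)
    ultimately show ?thesis by (simp add: tendsto_cong)
  qed
  have iterate: "(\<lambda>n. F j n - r ^ m * F (j + m) n) \<longlonglongrightarrow> 0" for m
  proof (induction m)
    case 0
    then show ?case by simp
  next
    case (Suc m)
    have "(\<lambda>n. r ^ m * (F (j + m) n - r * F (Suc (j + m)) n)) \<longlonglongrightarrow> 0"
      using \<open>j \<ge> 1\<close> by (intro tendsto_mult_right_zero shift) simp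
    from tendsto_add[OF Suc this] show ?case
      by (simp add: algebra_simps)
  qed
  have bounded: "\<forall>\<^sub>F n in sequentially. \<forall>j\<ge>1. \<bar>F j n\<bar> \<le> C"
    using v_bound y_bound filterlim_at_top_dense[THEN iffD1, OF N, rule_format, of 0]
  proof eventually_elim
    case (elim n)
    show ?case
    proof (intro allI impI)
      fix j :: nat assume "j \<ge> 1"
      have "\<bar>\<Sum>k\<in>{j<..n}. v k * y (k - j)\<bar> \<le> (\<Sum>k\<in>{j<..n}. \<bar>v k * y (k - j)\<bar>)"
        by (rule sum_abs)
      also have "\<dots> \<le> (\<Sum>k\<in>{j<..n}. ((v k)\<^sup>2 + (y (k - j))\<^sup>2) / 2)"
        by (intro sum_mono abs_mult_le_mean_square)
      also have "\<dots> = ((\<Sum>k\<in>{j<..n}. (v k)\<^sup>2) + (\<Sum>k\<in>{j<..n}. (y (k - j))\<^sup>2)) / 2"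
        by (simp add: sum.distrib flip: sum_divide_distrib)
      also have "(\<Sum>k\<in>{j<..n}. (v k)\<^sup>2) \<le> (\<Sum>k=1..n. (v k)\<^sup>2)"
        by (intro sum_mono2) auto
      also have "(\<Sum>k\<in>{j<..n}. (y (k - j))\<^sup>2) = (\<Sum>k\<in>(\<lambda>k. k - j) ` {j<..n}. (y k)\<^sup>2)"
        by (subst sum.reindex) (auto simp: inj_on_def)
      also have "\<dots> \<le> (\<Sum>k=1..n. (y k)\<^sup>2)"
        by (intro sum_mono2) auto
      finally have "\<bar>\<Sum>k\<in>{j<..n}. v k * y (k - j)\<bar> \<le> C * N n"
        using elim by simp
      then show "\<bar>F j n\<bar> \<le> C"
        using elim(3) by (simp add: F_def abs_divide divide_le_eq)
    qed
  qed
  have "F j \<longlonglongrightarrow> 0"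
  proof (rule LIMSEQ_I)
    fix e :: real assume "0 < e"
    have "(\<lambda>m. \<bar>r\<bar> ^ m * C) \<longlonglongrightarrow> 0"
      using r by (intro tendsto_mult_left_zero LIMSEQ_realpow_zero) auto
    then have "\<forall>\<^sub>F m in sequentially. \<bar>r\<bar> ^ m * C < e / 2"
      using \<open>0 < e\<close> by (intro order_tendstoD) auto
    then obtain m where m: "\<bar>r\<bar> ^ m * C < e / 2"
      using eventually_happens'[OF sequentially_bot] by blast
    have "\<forall>\<^sub>F n in sequentially. \<bar>F j n - r ^ m * F (j + m) n\<bar> < e / 2"
      using tendstoD[OF iterate[of m], of "e/2"] \<open>0 < e\<close> by (simp add: dist_real_def)
    with bounded have "\<forall>\<^sub>F n in sequentially. norm (F j n - 0) < e"
    proof eventually_elim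
      case (elim n)
      have "\<bar>r ^ m * F (j + m) n\<bar> \<le> \<bar>r\<bar> ^ m * C"
        using elim(1) \<open>j \<ge> 1\<close> by (auto simp: abs_mult power_abs intro!: mult_left_mono)
      then show ?case using elim(2) m by (simp add: abs_if split: if_splits)
    qed
    then show "\<exists>no. \<forall>n\<ge>no. norm (F j n - 0) < e"
      by (simp add: eventually_sequentially)
  qed
  then show ?thesis
    by (simp add: F_def[abs_def])
qed

text \<open>
  The noise \<open>w k\<close> combines two consecutive values of the process with coefficients of modulus at
  most one. Hence the process has at least a quarter of the energy of its noise, whatever the initial
  value.
\<close>
lemma innovation_energy_bound:
  fixes y w :: "nat \<Rightarrow> real"
  assumes "\<bar>r\<bar> < 1" and rec: "\<And>k. k \<ge> 1 \<Longrightarrow> y k = r * y (k - 1) + w k"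
  shows "(\<Sum>k=1..n. (w k)\<^sup>2) \<le> 4 * (\<Sum>k\<le>n. (y k)\<^sup>2)"
proof -
  have "(w k)\<^sup>2 \<le> 2 * (y k)\<^sup>2 + 2 * (y (k - 1))\<^sup>2" if "k \<ge> 1" for k
  proof -
    have w: "w k = y k - r * y (k - 1)"
      using rec[OF that] by simp
    have "(w k)\<^sup>2 + (y k + r * y (k - 1))\<^sup>2 = 2 * (y k)\<^sup>2 + 2 * (r\<^sup>2 * (y (k - 1))\<^sup>2)"
      unfolding w by (simp add: power2_eq_square algebra_simps)
    moreover have "r\<^sup>2 * (y (k - 1))\<^sup>2 \<le> 1 * (y (k - 1))\<^sup>2"
      using \<open>\<bar>r\<bar> < 1\<close> by (intro mult_right_mono) (auto simp: abs_square_le_1)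
    ultimately show ?thesis
      by (smt (verit) zero_le_power2)
  qed
  then have "(\<Sum>k=1..n. (w k)\<^sup>2) \<le> (\<Sum>k=1..n. 2 * (y k)\<^sup>2 + 2 * (y (k - 1))\<^sup>2)"
    by (intro sum_mono) auto
  also have "\<dots> = 2 * (\<Sum>k=1..n. (y k)\<^sup>2) + 2 * (\<Sum>k=1..n. (y (k - 1))\<^sup>2)"
    by (simp add: sum.distrib sum_distrib_left)
  also have "(\<Sum>k=1..n. (y (k - 1))\<^sup>2) = (\<Sum>k\<in>(\<lambda>k. k - 1) ` {1..n}. (y k)\<^sup>2)"
    by (subst sum.reindex) (auto simp: inj_on_def)
  also have "\<dots> \<le> (\<Sum>k\<le>n. (y k)\<^sup>2)"
    by (intro sum_mono2) auto
  also have "(\<Sum>k=1..n. (y k)\<^sup>2) \<le> (\<Sum>k\<le>n. (y k)\<^sup>2)"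
    by (intro sum_mono2) auto
  finally show ?thesis by simp
qed

section \<open>Quadratic sums along a path\<close>

text \<open>
  The next identities reduce all quadratic sums of the path to three of them: the energy
  \<open>\<Sum>k\<le>n. (x k)\<^sup>2\<close> and the sums of products at lags one and two. What remains are products of
  values at the two ends of the path. The upper index is \<open>Suc m\<close> so that the last two values
  \<open>x (Suc m)\<close> and \<open>x m\<close> can be named without truncated subtraction.
\<close>

lemma sum_second_order_combination_square:
  fixes x :: "nat \<Rightarrow> real"
  shows "(\<Sum>k=2..Suc m. (x k - (1 + h) * x (k - 1) + h * x (k - 2))\<^sup>2) =
    ((\<Sum>k\<le>Suc m. (x k)\<^sup>2) - (x 0)\<^sup>2 - (x 1)\<^sup>2)
    + (1 + h)\<^sup>2 * ((\<Sum>k\<le>Suc m. (x k)\<^sup>2) - (x 0)\<^sup>2 - (x (Suc m))\<^sup>2)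
    + h\<^sup>2 * ((\<Sum>k\<le>Suc m. (x k)\<^sup>2) - (x m)\<^sup>2 - (x (Suc m))\<^sup>2)
    - 2 * (1 + h) * ((\<Sum>k=1..Suc m. x k * x (k - 1)) - x 1 * x 0)
    + 2 * h * (\<Sum>k=2..Suc m. x k * x (k - 2))
    - 2 * h * (1 + h) * ((\<Sum>k=1..Suc m. x k * x (k - 1)) - x (Suc m) * x m)"
  by (induction m) (simp_all add: power2_eq_square algebra_simps)

text \<open>
  For a path of the second order recursion with coefficients \<open>a\<close> and \<open>- b\<close>, the factor in
  parentheses is the noise. These two identities are therefore the Yule-Walker equations at lags one
  and two, up to end terms and the correlation of the noise with the past.
\<close>

lemma sum_second_order_innovation_lag1:
  fixes x :: "nat \<Rightarrow> real"
  shows "(\<Sum>k=2..Suc m. (x k - a * x (k - 1) + b * x (k - 2)) * x (k - 1)) =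
    ((\<Sum>k=1..Suc m. x k * x (k - 1)) - x 1 * x 0)
    - a * ((\<Sum>k\<le>Suc m. (x k)\<^sup>2) - (x 0)\<^sup>2 - (x (Suc m))\<^sup>2)
    + b * ((\<Sum>k=1..Suc m. x k * x (k - 1)) - x (Suc m) * x m)"
  by (induction m) (simp_all add: power2_eq_square algebra_simps)

lemma sum_second_order_innovation_lag2:
  fixes x :: "nat \<Rightarrow> real"
  shows "(\<Sum>k=2..Suc m. (x k - a * x (k - 1) + b * x (k - 2)) * x (k - 2)) =
    (\<Sum>k=2..Suc m. x k * x (k - 2))
    - a * ((\<Sum>k=1..Suc m. x k * x (k - 1)) - x (Suc m) * x m)
    + b * ((\<Sum>k\<le>Suc m. (x k)\<^sup>2) - (x m)\<^sup>2 - (x (Suc m))\<^sup>2)"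
  by (induction m) (simp_all add: power2_eq_square algebra_simps)

lemma sum_residual_square:
  fixes x :: "nat \<Rightarrow> real"
  shows "(\<Sum>k=1..Suc m. (x k - h * x (k - 1))\<^sup>2) =
    ((\<Sum>k\<le>Suc m. (x k)\<^sup>2) - (x 0)\<^sup>2)
    - 2 * h * (\<Sum>k=1..Suc m. x k * x (k - 1))
    + h\<^sup>2 * ((\<Sum>k\<le>Suc m. (x k)\<^sup>2) - (x (Suc m))\<^sup>2)"
  by (induction m) (simp_all add: power2_eq_square algebra_simps)

lemma sum_lagged_square:
  fixes x :: "nat \<Rightarrow> real"
  shows "(\<Sum>k=1..Suc m. (x (k - 1))\<^sup>2) = (\<Sum>k\<le>Suc m. (x k)\<^sup>2) - (x (Suc m))\<^sup>2"
  by (induction m) simp_all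

text \<open>
  Here \<open>t\<close> and \<open>q\<close> are the limits of the empirical correlations at lags one and two. Since
  \<open>1 + \<theta> * \<rho> \<plusminus> (\<theta> + \<rho>) = (1 \<plusminus> \<theta>) * (1 \<plusminus> \<rho>)\<close>, the stability assumptions give \<open>\<bar>t\<bar> < 1\<close>, so that the
  limiting residual energy \<open>1 - t\<^sup>2\<close> is positive.
\<close>
lemma D_star_from_correlations:
  fixes \<theta> \<rho> :: real
  assumes "\<bar>\<theta>\<bar> < 1" "\<bar>\<rho>\<bar> < 1"
  defines "t \<equiv> (\<theta> + \<rho>) / (1 + \<theta> * \<rho>)"
  defines "q \<equiv> (\<theta> + \<rho>) * t - \<theta> * \<rho>"
  shows "1 + \<theta> * \<rho> > 0" and "1 - 2 * t * t + t\<^sup>2 > 0"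
    and "(1 + (1 + t)\<^sup>2 + t\<^sup>2 - 2 * (1 + t) * t + 2 * t * q - 2 * t * (1 + t) * t)
      / (1 - 2 * t * t + t\<^sup>2) = D_star \<theta> \<rho>"
proof -
  have "\<bar>\<theta> * \<rho>\<bar> < 1"
    using assms(1,2) abs_mult_less[of \<theta> 1 \<rho> 1] by (simp add: abs_mult)
  then show pos: "1 + \<theta> * \<rho> > 0" by simp
  define b where "b = \<theta> * \<rho>"
  have a: "\<theta> + \<rho> = t * (1 + b)"
    using pos by (simp add: t_def b_def)
  have "0 < (1 - \<theta>) * (1 - \<rho>)" "0 < (1 + \<theta>) * (1 + \<rho>)"
    using assms(1,2) by auto
  then have "\<bar>\<theta> + \<rho>\<bar> < 1 + \<theta> * \<rho>"
    by (simp add: algebra_simps abs_less_iff)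
  then have "\<bar>t\<bar> < 1"
    using pos by (simp add: t_def abs_divide)
  then have t: "1 - t\<^sup>2 > 0"
    by (simp add: abs_square_less_1)
  then show "1 - 2 * t * t + t\<^sup>2 > 0"
    by (simp add: power2_eq_square)
  have "1 + (1 + t)\<^sup>2 + t\<^sup>2 - 2 * (1 + t) * t + 2 * t * q - 2 * t * (1 + t) * t
      = 2 * (1 - t * b) * (1 - t\<^sup>2)"
    unfolding q_def a b_def[symmetric] by (simp add: power2_eq_square algebra_simps)
  moreover have "1 - 2 * t * t + t\<^sup>2 = 1 - t\<^sup>2"
    by (simp add: power2_eq_square)
  moreover have "D_star \<theta> \<rho> = 2 * (1 - t * b)"
    by (simp add: D_star_def rho_star_def t_def b_def algebra_simps)
  ultimately show "(1 + (1 + t)\<^sup>2 + t\<^sup>2 - 2 * (1 + t) * t + 2 * t * q - 2 * t * (1 + t) * t)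
      / (1 - 2 * t * t + t\<^sup>2) = D_star \<theta> \<rho>"
    using t by simp
qed

text \<open>
  The end terms of the quadratic identities are negligible against the energy \<open>S\<close>. Monotonicity of
  \<open>S\<close> transfers the hypothesis from the last value to the one before it.
\<close>
lemma normalised_edge_terms:
  fixes x S :: "nat \<Rightarrow> real"
  assumes S: "filterlim S at_top sequentially" and mono: "mono S"
    and edge: "(\<lambda>n. (x n)\<^sup>2 / S n) \<longlonglongrightarrow> 0"
  shows "(\<lambda>m. c / S (Suc m)) \<longlonglongrightarrow> 0"
    and "(\<lambda>m. (x (Suc m))\<^sup>2 / S (Suc m)) \<longlonglongrightarrow> 0"
    and "(\<lambda>m. (x m)\<^sup>2 / S (Suc m)) \<longlonglongrightarrow> 0"
    and "(\<lambda>m. (x (Suc m) * x m) / S (Suc m)) \<longlonglongrightarrow> 0"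
proof -
  have pos: "\<forall>\<^sub>F m in sequentially. 0 < S m"
    using S by (auto simp: filterlim_at_top_dense)
  show "(\<lambda>m. c / S (Suc m)) \<longlonglongrightarrow> 0"
    by (intro tendsto_divide_0[OF tendsto_const] filterlim_at_top_imp_at_infinity
        filterlim_compose[OF S filterlim_Suc])
  show new: "(\<lambda>m. (x (Suc m))\<^sup>2 / S (Suc m)) \<longlonglongrightarrow> 0"
    using edge by (rule LIMSEQ_Suc)
  show old: "(\<lambda>m. (x m)\<^sup>2 / S (Suc m)) \<longlonglongrightarrow> 0"
  proof (rule tendsto_sandwich[OF _ _ tendsto_const edge])
    have S_Suc: "S m \<le> S (Suc m)" for m
      using mono by (rule monoD) simp
    show "\<forall>\<^sub>F m in sequentially. 0 \<le> (x m)\<^sup>2 / S (Suc m)"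
      using pos
    proof eventually_elim
      case (elim m)
      then show ?case using S_Suc[of m] by (intro divide_nonneg_nonneg) auto
    qed
    show "\<forall>\<^sub>F m in sequentially. (x m)\<^sup>2 / S (Suc m) \<le> (x m)\<^sup>2 / S m"
      using pos
    proof eventually_elim
      case (elim m)
      then show ?case using S_Suc[of m] by (intro divide_left_mono mult_pos_pos) auto
    qed
  qed
  have pos': "\<forall>\<^sub>F m in sequentially. 0 < S (Suc m)"
    using pos by (rule eventually_compose_filterlim[OF _ filterlim_Suc])
  show "(\<lambda>m. (x (Suc m) * x m) / S (Suc m)) \<longlonglongrightarrow> 0"
  proof (rule Lim_null_comparison)
    show "(\<lambda>m. (x (Suc m))\<^sup>2 / S (Suc m) + (x m)\<^sup>2 / S (Suc m)) \<longlonglongrightarrow> 0"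
      using tendsto_add[OF new old] by simp
    show "\<forall>\<^sub>F m in sequentially. norm ((x (Suc m) * x m) / S (Suc m))
        \<le> (x (Suc m))\<^sup>2 / S (Suc m) + (x m)\<^sup>2 / S (Suc m)"
      using pos'
    proof eventually_elim
      case (elim m)
      have "\<bar>x (Suc m) * x m\<bar> \<le> (x (Suc m))\<^sup>2 + (x m)\<^sup>2"
        by (rule order_trans[OF abs_mult_le_mean_square]) simp
      then show ?case
        using elim by (simp add: abs_divide divide_right_mono flip: add_divide_distrib)
    qed
  qed
qed

text \<open>
  Both sums in the Durbin-Watson statistic are quadratic in the path with coefficients that depend
  on \<open>theta_hat\<close> alone. Dividing numerator and denominator by the energy turns the
  statistic into a continuous function of \<open>theta_hat\<close>, whose limit is also \<open>p\<close>, of the two empirical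
  correlations and of negligible end terms.
\<close>
lemma durbin_watson_tendsto_of_correlations:
  fixes x :: "nat \<Rightarrow> real" and p q :: real
  defines "S \<equiv> \<lambda>n. \<Sum>k\<le>n. (x k)\<^sup>2"
  assumes S: "filterlim S at_top sequentially"
    and edge: "(\<lambda>n. (x n)\<^sup>2 / S n) \<longlonglongrightarrow> 0"
    and lag1: "(\<lambda>n. (\<Sum>k=1..n. x k * x (k - 1)) / S n) \<longlonglongrightarrow> p"
    and lag2: "(\<lambda>n. (\<Sum>k=2..n. x k * x (k - 2)) / S n) \<longlonglongrightarrow> q"
    and pos: "1 - 2 * p * p + p\<^sup>2 > 0"
  shows "durbin_watson x \<longlonglongrightarrow>
    (1 + (1 + p)\<^sup>2 + p\<^sup>2 - 2 * (1 + p) * p + 2 * p * q - 2 * p * (1 + p) * p) / (1 - 2 * p * p + p\<^sup>2)"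
proof -
  have "mono S"
    unfolding S_def by (intro monoI sum_mono2) auto
  note small = normalised_edge_terms[OF S this edge]
  define s where "s m = S (Suc m)" for m
  define h where "h m = theta_hat x (Suc m)" for m
  define P where "P m = (\<Sum>k=1..Suc m. x k * x (k - 1)) / s m" for m
  define Q where "Q m = (\<Sum>k=2..Suc m. x k * x (k - 2)) / s m" for m
  define new where "new m = (x (Suc m))\<^sup>2 / s m" for m
  define old where "old m = (x m)\<^sup>2 / s m" for m
  define cross where "cross m = (x (Suc m) * x m) / s m" for m
  have new: "new \<longlonglongrightarrow> 0" and old: "old \<longlonglongrightarrow> 0" and cross: "cross \<longlonglongrightarrow> 0"
    and const: "(\<lambda>m. c / s m) \<longlonglongrightarrow> 0" for c
    unfolding new_def[abs_def] old_def[abs_def] cross_def[abs_def] s_def by (rule small)+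
  have P: "P \<longlonglongrightarrow> p" and Q: "Q \<longlonglongrightarrow> q"
    unfolding P_def[abs_def] Q_def[abs_def] s_def by (rule LIMSEQ_Suc[OF lag1] LIMSEQ_Suc[OF lag2])+
  have s_pos: "\<forall>\<^sub>F m in sequentially. 0 < s m"
    using filterlim_compose[OF S filterlim_Suc] by (auto simp: filterlim_at_top_dense s_def)
  have "\<forall>\<^sub>F m in sequentially. P m / (1 - new m) = h m"
    using s_pos
  proof eventually_elim
    case (elim m)
    have "1 - new m = (s m - (x (Suc m))\<^sup>2) / s m"
      using elim by (simp add: new_def diff_divide_distrib)
    moreover have "h m = (P m * s m) / (s m - (x (Suc m))\<^sup>2)"
      unfolding h_def theta_hat_def sum_lagged_square P_def using elim by (simp add: s_def S_def)
    ultimately show ?case by simp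
  qed
  moreover have "(\<lambda>m. P m / (1 - new m)) \<longlonglongrightarrow> p / (1 - 0)"
    by (intro tendsto_intros P new) simp
  ultimately have h: "h \<longlonglongrightarrow> p"
    by (simp add: tendsto_cong)
  define num where "num m = (x 1 - (1 + h m) * x 0)\<^sup>2 / s m + (1 - (x 0)\<^sup>2 / s m - (x 1)\<^sup>2 / s m)
    + (1 + h m)\<^sup>2 * (1 - (x 0)\<^sup>2 / s m - new m) + (h m)\<^sup>2 * (1 - old m - new m)
    - 2 * (1 + h m) * (P m - (x 1 * x 0) / s m) + 2 * h m * Q m
    - 2 * h m * (1 + h m) * (P m - cross m)" for m
  define den where "den m = 1 - 2 * h m * P m + (h m)\<^sup>2 * (1 - new m)" for m
  have "(\<lambda>m. (x 1 - (1 + h m) * x 0) * ((x 1 - (1 + h m) * x 0) / s m)) \<longlonglongrightarrow> (x 1 - (1 + p) * x 0) * 0"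
  proof (intro tendsto_mult tendsto_intros h)
    have "(\<lambda>m. (x 1 - x 0) / s m - h m * (x 0 / s m)) \<longlonglongrightarrow> 0 - p * 0"
      by (intro tendsto_intros const h)
    then show "(\<lambda>m. (x 1 - (1 + h m) * x 0) / s m) \<longlonglongrightarrow> 0"
      by (simp add: diff_divide_distrib algebra_simps add_divide_distrib)
  qed
  then have first: "(\<lambda>m. (x 1 - (1 + h m) * x 0)\<^sup>2 / s m) \<longlonglongrightarrow> 0"
    by (simp add: power2_eq_square)
  have "num \<longlonglongrightarrow> 0 + (1 - 0 - 0) + (1 + p)\<^sup>2 * (1 - 0 - 0) + p\<^sup>2 * (1 - 0 - 0)
      - 2 * (1 + p) * (p - 0) + 2 * p * q - 2 * p * (1 + p) * (p - 0)"
    unfolding num_def[abs_def] by (intro tendsto_intros first const P Q h new old cross)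
  moreover have "den \<longlonglongrightarrow> 1 - 2 * p * p + p\<^sup>2 * (1 - 0)"
    unfolding den_def[abs_def] by (intro tendsto_intros P h new)
  ultimately have lim: "(\<lambda>m. num m / den m) \<longlonglongrightarrow>
    (1 + (1 + p)\<^sup>2 + p\<^sup>2 - 2 * (1 + p) * p + 2 * p * q - 2 * p * (1 + p) * p) / (1 - 2 * p * p + p\<^sup>2)"
    using pos by (intro tendsto_divide) auto
  have "\<forall>\<^sub>F m in sequentially. num m / den m = durbin_watson x (Suc m)"
    using s_pos
  proof eventually_elim
    case (elim m)
    have s_eq: "(\<Sum>k\<le>Suc m. (x k)\<^sup>2) = s m"
      by (simp add: s_def S_def)
    have P_eq: "(\<Sum>k=1..Suc m. x k * x (k - 1)) = P m * s m"
      and Q_eq: "(\<Sum>k=2..Suc m. x k * x (k - 2)) = Q m * s m"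
      using elim by (simp_all add: P_def Q_def)
    have edge_eq: "(x (Suc m))\<^sup>2 = new m * s m" "(x m)\<^sup>2 = old m * s m" "x (Suc m) * x m = cross m * s m"
      using elim by (simp_all add: new_def old_def cross_def)
    have "(\<Sum>k=1..Suc m. (residual x (Suc m) k - residual x (Suc m) (k - 1))\<^sup>2)
        = (x 1 - (1 + h m) * x 0)\<^sup>2 + (\<Sum>k=2..Suc m. (x k - (1 + h m) * x (k - 1) + h m * x (k - 2))\<^sup>2)"
    proof -
      have "{1..Suc m} = insert 1 {2..Suc m}" by auto
      moreover have "(\<Sum>k=2..Suc m. (residual x (Suc m) k - residual x (Suc m) (k - 1))\<^sup>2)
          = (\<Sum>k=2..Suc m. (x k - (1 + h m) * x (k - 1) + h m * x (k - 2))\<^sup>2)"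
      proof (intro sum.cong refl)
        fix k assume "k \<in> {2..Suc m}"
        then obtain i where "k = Suc (Suc i)"
          by (metis atLeastAtMost_iff add_2_eq_Suc le_Suc_ex)
        then show "(residual x (Suc m) k - residual x (Suc m) (k - 1))\<^sup>2
            = (x k - (1 + h m) * x (k - 1) + h m * x (k - 2))\<^sup>2"
          by (simp add: residual_def h_def algebra_simps)
      qed
      moreover have "(residual x (Suc m) 1 - residual x (Suc m) (1 - 1)) = x 1 - (1 + h m) * x 0"
        by (simp add: residual_def h_def algebra_simps)
      ultimately show ?thesis by simp
    qed
    also have "\<dots> = num m * s m"
    proof -
      \<comment> \<open>The identity is linear in the scale once the squared coefficients are treated as atoms;
      expanding them would leave a large rational identity.\<close>
      have "F + ((s' - A - B) + H * (s' - A - n * s') + K * (s' - l * s' - n * s')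
            - u * (P' * s' - G) + w * (Q' * s') - t * (P' * s' - c * s'))
          = (F / s' + (1 - A / s' - B / s') + H * (1 - A / s' - n) + K * (1 - l - n)
            - u * (P' - G / s') + w * Q' - t * (P' - c)) * s'"
        if "s' > 0" for F s' A B H n K l u P' G w Q' t c :: real
      proof -
        define F' A' B' G' where "F' = F / s'" "A' = A / s'" "B' = B / s'" "G' = G / s'"
        then have eq: "F = F' * s'" "A = A' * s'" "B = B' * s'" "G = G' * s'"
          using that by auto
        have "F' * s' / s' = F'" "A' * s' / s' = A'" "B' * s' / s' = B'" "G' * s' / s' = G'"
          using that by auto
        then show ?thesis
          unfolding eq by (simp only:) (simp add: algebra_simps)
      qed
      from this[OF elim] show ?thesis
        unfolding sum_second_order_combination_square s_eq P_eq Q_eq edge_eq num_def by blast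
    qed
    finally have num_eq: "(\<Sum>k=1..Suc m. (residual x (Suc m) k - residual x (Suc m) (k - 1))\<^sup>2) = num m * s m" .
    have "(\<Sum>k=0..Suc m. (residual x (Suc m) k)\<^sup>2)
        = (x 0)\<^sup>2 + (\<Sum>k=1..Suc m. (x k - h m * x (k - 1))\<^sup>2)"
      by (simp add: sum.atLeast_Suc_atMost residual_def h_def)
    also have "\<dots> = den m * s m"
      unfolding sum_residual_square s_eq P_eq edge_eq den_def by (simp add: algebra_simps)
    finally show ?case
      unfolding durbin_watson_def num_eq using elim by (simp del: sum.cl_ivl_Suc)
  qed
  with lim show ?thesis
    by (intro LIMSEQ_imp_Suc[of "durbin_watson x"]) (simp add: tendsto_cong)
qed

section \<open>The limit along a single path\<close>

text \<open>
  The path satisfies \<open>x k = a * x (k - 1) - b * x (k - 2) + v k\<close> with \<open>a = \<theta> + \<rho>\<close> and \<open>b = \<theta> * \<rho>\<close>.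
  Multiply this by \<open>x (k - 1)\<close> and by \<open>x (k - 2)\<close>, sum over \<open>k\<close> and divide by the energy \<open>S n\<close> of the
  path. The sums that contain \<open>v k\<close> vanish in the limit, because \<open>v\<close> is asymptotically
  uncorrelated with the past of the path, and the rest are the Yule-Walker equations
  \<open>(1 + b) * p = a\<close> and \<open>q = a * p - b\<close> for the empirical correlations. The lower
  bound \<open>S n \<ge> const * n\<close>, inherited from the noise, turns every \<open>o(n)\<close> into \<open>o(S n)\<close>.
\<close>
lemma durbin_watson_path_limit:
  fixes x e v :: "nat \<Rightarrow> real" and \<theta> \<rho> c :: real
  assumes \<theta>: "\<bar>\<theta>\<bar> < 1" and \<rho>: "\<bar>\<rho>\<bar> < 1"
    and x: "\<And>k. k \<ge> 1 \<Longrightarrow> x k = \<theta> * x (k - 1) + e k"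
    and e: "\<And>k. k \<ge> 1 \<Longrightarrow> e k = \<rho> * e (k - 1) + v k"
    and uncorrelated: "\<And>j. j \<ge> 1 \<Longrightarrow> (\<lambda>n. (\<Sum>k\<in>{j<..n}. v k * v (k - j)) / n) \<longlonglongrightarrow> 0"
    and sublinear: "(\<lambda>n. v n / sqrt n) \<longlonglongrightarrow> 0"
    and "c > 0" and energy: "\<forall>\<^sub>F n in sequentially. c * n \<le> (\<Sum>k=1..n. (v k)\<^sup>2)"
  shows "durbin_watson x \<longlonglongrightarrow> D_star \<theta> \<rho>"
proof -
  define S where "S n = (\<Sum>k\<le>n. (x k)\<^sup>2)" for n
  define a b where "a = \<theta> + \<rho>" and "b = \<theta> * \<rho>"
  have e_energy: "(\<Sum>k=1..n. (e k)\<^sup>2) \<le> 4 * S n" for n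
    unfolding S_def using \<theta> x by (rule innovation_energy_bound)
  have v_energy: "(\<Sum>k=1..n. (v k)\<^sup>2) \<le> 16 * S n + 4 * (e 0)\<^sup>2" for n
  proof -
    have "(\<Sum>k=1..n. (v k)\<^sup>2) \<le> 4 * (\<Sum>k\<le>n. (e k)\<^sup>2)"
      using \<rho> e by (rule innovation_energy_bound)
    also have "(\<Sum>k\<le>n. (e k)\<^sup>2) = (e 0)\<^sup>2 + (\<Sum>k=1..n. (e k)\<^sup>2)"
    proof -
      have "{..n} = insert 0 {1..n}" by auto
      then show ?thesis by simp
    qed
    finally show ?thesis using e_energy[of n] by simp
  qed
  \<comment> \<open>The constant \<open>e 0\<close> is absorbed into half of the linear growth of the noise energy.\<close>
  have S_linear: "\<forall>\<^sub>F n in sequentially. c / 32 * n \<le> S n"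
    using energy eventually_ge_at_top[of "nat \<lceil>8 * (e 0)\<^sup>2 / c\<rceil>"]
  proof eventually_elim
    case (elim n)
    have "8 * (e 0)\<^sup>2 / c \<le> n"
      using elim(2) by linarith
    then have "8 * (e 0)\<^sup>2 \<le> c * n"
      using \<open>c > 0\<close> by (simp add: field_simps)
    then show ?case
      using elim(1) v_energy[of n] by simp
  qed
  have S_top: "filterlim S at_top sequentially"
  proof (rule filterlim_at_top_mono[OF _ S_linear])
    show "filterlim (\<lambda>n. c / 32 * real n) at_top sequentially"
      using \<open>c > 0\<close> by (intro filterlim_tendsto_pos_mult_at_top[OF tendsto_const] filterlim_real_sequentially) auto
  qed
  have rescale: "(\<lambda>n. f n / S n) \<longlonglongrightarrow> 0" if f: "(\<lambda>n. f n / n) \<longlonglongrightarrow> 0" for f :: "nat \<Rightarrow> real"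
  proof (rule Lim_null_comparison)
    show "(\<lambda>n. 32 / c * \<bar>f n / n\<bar>) \<longlonglongrightarrow> 0"
      using f by (intro tendsto_mult_right_zero tendsto_rabs_zero)
    show "\<forall>\<^sub>F n in sequentially. norm (f n / S n) \<le> 32 / c * \<bar>f n / n\<bar>"
      using S_linear eventually_gt_at_top[of 0]
    proof eventually_elim
      case (elim n)
      have pos: "0 < c / 32 * n"
        using elim(2) \<open>c > 0\<close> by simp
      then have "0 < S n"
        using elim(1) by linarith
      then have "norm (f n / S n) = \<bar>f n\<bar> / S n" by simp
      also have "\<dots> \<le> \<bar>f n\<bar> / (c / 32 * n)"
        using elim(1) by (intro divide_left_mono mult_pos_pos pos \<open>0 < S n\<close>) auto
      also have "\<dots> = 32 / c * \<bar>f n / n\<bar>" by simp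
      finally show ?case .
    qed
  qed
  have "(\<lambda>n. x n / sqrt n) \<longlonglongrightarrow> 0"
    using autoregression_sublinear_growth[OF \<theta> x autoregression_sublinear_growth[OF \<rho> e sublinear]] .
  then have "(\<lambda>n. (x n / sqrt n)\<^sup>2) \<longlonglongrightarrow> 0\<^sup>2"
    by (rule tendsto_power)
  moreover have "(x n / sqrt n)\<^sup>2 = (x n)\<^sup>2 / n" for n
    by (simp add: power_divide)
  ultimately have "(\<lambda>n. (x n)\<^sup>2 / n) \<longlonglongrightarrow> 0"
    by simp
  then have edge: "(\<lambda>n. (x n)\<^sup>2 / S n) \<longlonglongrightarrow> 0"
    by (rule rescale)
  have e0_small: "\<forall>\<^sub>F n in sequentially. 4 * (e 0)\<^sup>2 \<le> S n"
    using S_top by (simp add: filterlim_at_top)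
  have S_pos: "\<forall>\<^sub>F n in sequentially. 0 < S n"
    using S_top by (simp add: filterlim_at_top_dense)
  have v_bound: "\<forall>\<^sub>F n in sequentially. (\<Sum>k=1..n. (v k)\<^sup>2) \<le> 17 * S n"
    using e0_small
  proof eventually_elim
    case (elim n)
    then show ?case using v_energy[of n] by simp
  qed
  have e_bound: "\<forall>\<^sub>F n in sequentially. (\<Sum>k=1..n. (e k)\<^sup>2) \<le> 17 * S n"
    using S_pos
  proof eventually_elim
    case (elim n)
    then show ?case using e_energy[of n] by simp
  qed
  have x_bound: "\<forall>\<^sub>F n in sequentially. (\<Sum>k=1..n. (x k)\<^sup>2) \<le> 17 * S n"
    using S_pos
  proof eventually_elim
    case (elim n)
    have "(\<Sum>k=1..n. (x k)\<^sup>2) \<le> S n"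
      unfolding S_def by (intro sum_mono2) auto
    then show ?case using elim by simp
  qed
  \<comment> \<open>The vanishing lag sums are carried from \<open>v\<close> to \<open>e\<close> and from \<open>e\<close> to \<open>x\<close>.\<close>
  have e_lag: "(\<lambda>n. (\<Sum>k\<in>{j<..n}. v k * e (k - j)) / S n) \<longlonglongrightarrow> 0" if "j \<ge> 1" for j
    using lag_sums_vanish_through_autoregression[OF \<rho> e S_top v_bound e_bound rescale[OF uncorrelated] that] .
  have x_lag: "(\<lambda>n. (\<Sum>k\<in>{j<..n}. v k * x (k - j)) / S n) \<longlonglongrightarrow> 0" if "j \<ge> 1" for j
    using lag_sums_vanish_through_autoregression[OF \<theta> x S_top v_bound x_bound e_lag that] .
  have v_eq: "v k = x k - a * x (k - 1) + b * x (k - 2)" if "k \<ge> 2" for k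
  proof -
    have "k - 1 - 1 = k - 2" by simp
    then have "e (k - 1) = x (k - 1) - \<theta> * x (k - 2)"
      using x[of "k - 1"] that by (simp del: diff_diff_left)
    moreover have "v k = x k - \<theta> * x (k - 1) - \<rho> * e (k - 1)"
      using x[of k] e[of k] that by simp
    ultimately have "v k = x k - \<theta> * x (k - 1) - \<rho> * (x (k - 1) - \<theta> * x (k - 2))"
      by simp
    then show ?thesis
      by (simp add: a_def b_def algebra_simps)
  qed
  have "mono S"
    unfolding S_def[abs_def] by (intro monoI sum_mono2) auto
  note small = normalised_edge_terms[OF S_top this edge]
  define p where "p = a / (1 + b)"
  define q where "q = a * p - b"
  define P where "P n = (\<Sum>k=1..n. x k * x (k - 1)) / S n" for n
  define Q where "Q n = (\<Sum>k=2..n. x k * x (k - 2)) / S n" for n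
  define G1 where "G1 n = (\<Sum>k=2..n. v k * x (k - 1)) / S n" for n
  define G2 where "G2 n = (\<Sum>k=2..n. v k * x (k - 2)) / S n" for n
  note corr = D_star_from_correlations[OF \<theta> \<rho>, folded a_def b_def, folded p_def, folded q_def]
  have S_Suc_pos: "\<forall>\<^sub>F m in sequentially. 0 < S (Suc m)"
    using S_pos by (rule eventually_compose_filterlim[OF _ filterlim_Suc])
  have "G1 \<longlonglongrightarrow> 0"
  proof -
    have "{2..n} = {1<..n}" for n :: nat by auto
    then show ?thesis using x_lag[of 1] by (simp add: G1_def[abs_def])
  qed
  have G2: "G2 \<longlonglongrightarrow> 0"
  proof -
    have "(\<lambda>n. v 2 * x 0 / S n + (\<Sum>k\<in>{2<..n}. v k * x (k - 2)) / S n) \<longlonglongrightarrow> 0 + 0"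
      by (intro tendsto_add x_lag tendsto_divide_0[OF tendsto_const] filterlim_at_top_imp_at_infinity S_top) simp
    moreover have "\<forall>\<^sub>F n in sequentially. v 2 * x 0 / S n + (\<Sum>k\<in>{2<..n}. v k * x (k - 2)) / S n = G2 n"
      using eventually_ge_at_top[of 2]
    proof eventually_elim
      case (elim n)
      then have "{2..n} = insert 2 {2<..n}" by auto
      then show ?case by (simp add: G2_def add_divide_distrib)
    qed
    ultimately show ?thesis by (simp add: tendsto_cong)
  qed
  define new where "new m = (x (Suc m))\<^sup>2 / S (Suc m)" for m
  define old where "old m = (x m)\<^sup>2 / S (Suc m)" for m
  define cross where "cross m = (x (Suc m) * x m) / S (Suc m)" for m
  have new: "new \<longlonglongrightarrow> 0" and old: "old \<longlonglongrightarrow> 0" and cross: "cross \<longlonglongrightarrow> 0"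
    and const: "(\<lambda>m. c / S (Suc m)) \<longlonglongrightarrow> 0" for c
    unfolding new_def[abs_def] old_def[abs_def] cross_def[abs_def] by (rule small)+
  have "(\<lambda>m. (a * (1 - (x 0)\<^sup>2 / S (Suc m) - new m) + b * cross m + x 1 * x 0 / S (Suc m) + G1 (Suc m)) / (1 + b))
      \<longlonglongrightarrow> (a * (1 - 0 - 0) + b * 0 + 0 + 0) / (1 + b)"
    using corr(1) by (intro tendsto_intros const new cross LIMSEQ_Suc[OF \<open>G1 \<longlonglongrightarrow> 0\<close>]) auto
  moreover have "\<forall>\<^sub>F m in sequentially.
      (a * (1 - (x 0)\<^sup>2 / S (Suc m) - new m) + b * cross m + x 1 * x 0 / S (Suc m) + G1 (Suc m)) / (1 + b) = P (Suc m)"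
    using S_Suc_pos
  proof eventually_elim
    case (elim m)
    have "(\<Sum>k=2..Suc m. v k * x (k - 1)) = (\<Sum>k=2..Suc m. (x k - a * x (k - 1) + b * x (k - 2)) * x (k - 1))"
      by (intro sum.cong refl) (simp add: v_eq)
    also note sum_second_order_innovation_lag1
    finally have "G1 (Suc m) = ((P (Suc m) * S (Suc m) - x 1 * x 0) - a * (S (Suc m) - (x 0)\<^sup>2 - (x (Suc m))\<^sup>2)
        + b * (P (Suc m) * S (Suc m) - x (Suc m) * x m)) / S (Suc m)"
      using elim by (simp only: G1_def P_def S_def[symmetric]) simp
    also have "\<dots> = (1 + b) * P (Suc m) - x 1 * x 0 / S (Suc m)
        - a * (1 - (x 0)\<^sup>2 / S (Suc m) - new m) - b * cross m"
      using elim by (simp add: new_def cross_def field_simps)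
    finally show ?case
      using corr(1) by (simp add: field_simps)
  qed
  ultimately have "(\<lambda>m. P (Suc m)) \<longlonglongrightarrow> p"
    by (simp add: tendsto_cong p_def)
  have "(\<lambda>m. a * (P (Suc m) - cross m) - b * (1 - old m - new m) + G2 (Suc m)) \<longlonglongrightarrow> a * (p - 0) - b * (1 - 0 - 0) + 0"
    by (intro tendsto_intros old new cross LIMSEQ_Suc[OF G2] \<open>(\<lambda>m. P (Suc m)) \<longlonglongrightarrow> p\<close>)
  moreover have "\<forall>\<^sub>F m in sequentially. a * (P (Suc m) - cross m) - b * (1 - old m - new m) + G2 (Suc m) = Q (Suc m)"
    using S_Suc_pos
  proof eventually_elim
    case (elim m)
    have "(\<Sum>k=2..Suc m. v k * x (k - 2)) = (\<Sum>k=2..Suc m. (x k - a * x (k - 1) + b * x (k - 2)) * x (k - 2))"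
      by (intro sum.cong refl) (simp add: v_eq)
    also note sum_second_order_innovation_lag2
    finally have "G2 (Suc m) = (Q (Suc m) * S (Suc m) - a * (P (Suc m) * S (Suc m) - x (Suc m) * x m)
        + b * (S (Suc m) - (x m)\<^sup>2 - (x (Suc m))\<^sup>2)) / S (Suc m)"
      using elim by (simp only: G2_def P_def Q_def S_def[symmetric]) simp
    also have "\<dots> = Q (Suc m) - a * (P (Suc m) - cross m) + b * (1 - old m - new m)"
      using elim by (simp add: old_def new_def cross_def field_simps)
    finally show ?case by simp
  qed
  ultimately have "(\<lambda>m. Q (Suc m)) \<longlonglongrightarrow> q"
    by (simp add: tendsto_cong q_def)
  have "durbin_watson x \<longlonglongrightarrow> (1 + (1 + p)\<^sup>2 + p\<^sup>2 - 2 * (1 + p) * p + 2 * p * q - 2 * p * (1 + p) * p) / (1 - 2 * p * p + p\<^sup>2)"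
  proof (rule durbin_watson_tendsto_of_correlations)
    show "filterlim (\<lambda>n. \<Sum>k\<le>n. (x k)\<^sup>2) at_top sequentially"
      using S_top by (simp add: S_def[abs_def])
    show "(\<lambda>n. (x n)\<^sup>2 / (\<Sum>k\<le>n. (x k)\<^sup>2)) \<longlonglongrightarrow> 0"
      using edge by (simp add: S_def)
    show "(\<lambda>n. (\<Sum>k=1..n. x k * x (k - 1)) / (\<Sum>k\<le>n. (x k)\<^sup>2)) \<longlonglongrightarrow> p"
      using LIMSEQ_imp_Suc[OF \<open>(\<lambda>m. P (Suc m)) \<longlonglongrightarrow> p\<close>] by (simp add: P_def[abs_def] S_def)
    show "(\<lambda>n. (\<Sum>k=2..n. x k * x (k - 2)) / (\<Sum>k\<le>n. (x k)\<^sup>2)) \<longlonglongrightarrow> q"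
      using LIMSEQ_imp_Suc[OF \<open>(\<lambda>m. Q (Suc m)) \<longlonglongrightarrow> q\<close>] by (simp add: Q_def[abs_def] S_def)
    show "1 - 2 * p * p + p\<^sup>2 > 0"
      by (rule corr(2))
  qed
  then show ?thesis
    by (simp only: corr(3))
qed

section \<open>A strong law for orthogonal random variables\<close>

lemma integrable_mult_of_squares:
  fixes f g :: "'a \<Rightarrow> real"
  assumes [measurable]: "f \<in> borel_measurable M" "g \<in> borel_measurable M"
    and f: "integrable M (\<lambda>x. (f x)\<^sup>2)" and g: "integrable M (\<lambda>x. (g x)\<^sup>2)"
  shows "integrable M (\<lambda>x. f x * g x)"
proof (rule Bochner_Integration.integrable_bound)
  show "integrable M (\<lambda>x. (f x)\<^sup>2 + (g x)\<^sup>2)"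
    using f g by simp
  show "AE x in M. norm (f x * g x) \<le> norm ((f x)\<^sup>2 + (g x)\<^sup>2)"
  proof (rule AE_I2)
    fix x
    have "\<bar>f x * g x\<bar> \<le> (f x)\<^sup>2 + (g x)\<^sup>2"
      by (rule order_trans[OF abs_mult_le_mean_square]) simp
    then show "norm (f x * g x) \<le> norm ((f x)\<^sup>2 + (g x)\<^sup>2)"
      unfolding real_norm_def by (rule order_trans[OF _ abs_ge_self])
  qed
qed simp

text \<open>
  By monotone convergence the series of the \<open>f n\<close> has a finite integral, so it converges almost
  everywhere and its terms tend to zero.
\<close>
lemma AE_tendsto_zero_of_summable_integral:
  fixes f :: "nat \<Rightarrow> 'a \<Rightarrow> real"
  assumes int: "\<And>n. integrable M (f n)" and nonneg: "\<And>n x. 0 \<le> f n x"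
    and sum: "summable (\<lambda>n. \<integral>x. f n x \<partial>M)"
  shows "AE x in M. (\<lambda>n. f n x) \<longlonglongrightarrow> 0"
proof -
  have [measurable]: "f n \<in> borel_measurable M" for n
    using int by simp
  have "(\<integral>\<^sup>+x. (\<Sum>n. ennreal (f n x)) \<partial>M) = (\<Sum>n. \<integral>\<^sup>+x. ennreal (f n x) \<partial>M)"
    by (rule nn_integral_suminf) simp
  also have "\<dots> = (\<Sum>n. ennreal (\<integral>x. f n x \<partial>M))"
    using int nonneg by (simp add: nn_integral_eq_integral)
  also have "\<dots> = ennreal (\<Sum>n. \<integral>x. f n x \<partial>M)"
    by (rule suminf_ennreal_eq) (auto intro: sum summable_sums Bochner_Integration.integral_nonneg nonneg)
  finally have "(\<integral>\<^sup>+x. (\<Sum>n. ennreal (f n x)) \<partial>M) \<noteq> \<infinity>"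
    by simp
  then have "AE x in M. (\<Sum>n. ennreal (f n x)) \<noteq> \<infinity>"
    by (intro nn_integral_PInf_AE) auto
  then show ?thesis
  proof (rule AE_mp, intro AE_I2 impI)
    fix x assume "(\<Sum>n. ennreal (f n x)) \<noteq> \<infinity>"
    then have "summable (\<lambda>n. f n x)"
      using nonneg by (intro summable_suminf_not_top) auto
    then show "(\<lambda>n. f n x) \<longlonglongrightarrow> 0"
      by (rule summable_LIMSEQ_zero)
  qed
qed

text \<open>
  Pythagoras: the mixed terms have expectation zero, so only the diagonal contributes.
\<close>
lemma (in prob_space) expectation_square_sum_orthogonal:
  fixes Z :: "nat \<Rightarrow> 'a \<Rightarrow> real"
  assumes "finite A"
    and meas[measurable]: "\<And>k. k \<in> A \<Longrightarrow> Z k \<in> borel_measurable M"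
    and sq: "\<And>k. k \<in> A \<Longrightarrow> integrable M (\<lambda>\<omega>. (Z k \<omega>)\<^sup>2)"
    and orth: "\<And>i k. i \<in> A \<Longrightarrow> k \<in> A \<Longrightarrow> i \<noteq> k \<Longrightarrow> expectation (\<lambda>\<omega>. Z i \<omega> * Z k \<omega>) = 0"
    and bound: "\<And>k. k \<in> A \<Longrightarrow> expectation (\<lambda>\<omega>. (Z k \<omega>)\<^sup>2) \<le> C"
  shows "integrable M (\<lambda>\<omega>. (\<Sum>k\<in>A. Z k \<omega>)\<^sup>2)" (is ?int)
    and "expectation (\<lambda>\<omega>. (\<Sum>k\<in>A. Z k \<omega>)\<^sup>2) \<le> C * card A" (is ?bound)
proof -
  have prod: "integrable M (\<lambda>\<omega>. Z i \<omega> * Z k \<omega>)" if "i \<in> A" "k \<in> A" for i k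
    using that meas sq by (intro integrable_mult_of_squares) auto
  have expand: "(\<Sum>k\<in>A. Z k \<omega>)\<^sup>2 = (\<Sum>i\<in>A. \<Sum>k\<in>A. Z i \<omega> * Z k \<omega>)" for \<omega>
    by (simp add: power2_eq_square sum_product)
  show ?int
    unfolding expand by (intro Bochner_Integration.integrable_sum prod)
  have "expectation (\<lambda>\<omega>. (\<Sum>k\<in>A. Z k \<omega>)\<^sup>2)
      = (\<Sum>i\<in>A. \<Sum>k\<in>A. expectation (\<lambda>\<omega>. Z i \<omega> * Z k \<omega>))"
    unfolding expand
    by (subst Bochner_Integration.integral_sum; intro sum.cong refl Bochner_Integration.integral_sum
        Bochner_Integration.integrable_sum prod; assumption)
  also have "\<dots> = (\<Sum>i\<in>A. \<Sum>k\<in>A. if k = i then expectation (\<lambda>\<omega>. (Z k \<omega>)\<^sup>2) else 0)"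
    using orth by (intro sum.cong refl) (auto simp: power2_eq_square)
  also have "\<dots> = (\<Sum>i\<in>A. expectation (\<lambda>\<omega>. (Z i \<omega>)\<^sup>2))"
    using \<open>finite A\<close> by simp
  also have "\<dots> \<le> (\<Sum>i\<in>A. C)"
    by (intro sum_mono bound)
  finally show ?bound
    by (simp add: mult.commute)
qed

text \<open>
  Chebyshev's inequality is too weak along all \<open>n\<close> but suffices along the squares \<open>m\<^sup>2\<close>. Between
  consecutive squares there are only \<open>2 * m + 1\<close> partial sums, each at distance \<open>O(m)\<close> in second
  moment from the one at \<open>m\<^sup>2\<close>. The single variable \<open>A m\<close> dominates the whole block: its expectation
  is \<open>O(1 / m\<^sup>2)\<close>, hence summable, and every average with \<open>m\<^sup>2 \<le> n < (m + 1)\<^sup>2\<close> has square at most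
  \<open>2 * A m\<close>.
\<close>
lemma (in prob_space) strong_law_orthogonal:
  fixes Z :: "nat \<Rightarrow> 'a \<Rightarrow> real"
  assumes meas: "\<And>k. k \<ge> 1 \<Longrightarrow> Z k \<in> borel_measurable M"
    and sq: "\<And>k. k \<ge> 1 \<Longrightarrow> integrable M (\<lambda>\<omega>. (Z k \<omega>)\<^sup>2)"
    and orth: "\<And>i k. 1 \<le> i \<Longrightarrow> i < k \<Longrightarrow> expectation (\<lambda>\<omega>. Z i \<omega> * Z k \<omega>) = 0"
    and bound: "\<And>k. k \<ge> 1 \<Longrightarrow> expectation (\<lambda>\<omega>. (Z k \<omega>)\<^sup>2) \<le> C"
  shows "AE \<omega> in M. (\<lambda>n. (\<Sum>k=1..n. Z k \<omega>) / real n) \<longlonglongrightarrow> 0"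
proof -
  have orth': "expectation (\<lambda>\<omega>. Z i \<omega> * Z k \<omega>) = 0" if "1 \<le> i" "1 \<le> k" "i \<noteq> k" for i k
    using orth[of i k] orth[of k i] that by (cases "i < k") (auto simp: mult.commute)
  have C: "0 \<le> C"
    using bound[of 1] by (rule order_trans[rotated]) auto
  note second_moment = expectation_square_sum_orthogonal[where Z = Z and C = C]
  define L where "L m \<omega> = (\<Sum>k=1..m\<^sup>2. Z k \<omega>)" for m \<omega>
  define R where "R m j \<omega> = (\<Sum>k=m\<^sup>2+1..m\<^sup>2+j. Z k \<omega>)" for m j \<omega>
  define A where "A m \<omega> = ((L m \<omega>)\<^sup>2 + (\<Sum>j\<le>2*m. (R m j \<omega>)\<^sup>2)) / (real m)^4" for m \<omega>
  have L: "integrable M (\<lambda>\<omega>. (L m \<omega>)\<^sup>2)" "expectation (\<lambda>\<omega>. (L m \<omega>)\<^sup>2) \<le> C * (real m)\<^sup>2" for m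
    using second_moment[of "{1..m\<^sup>2}"] meas sq orth' bound unfolding L_def by auto
  have R: "integrable M (\<lambda>\<omega>. (R m j \<omega>)\<^sup>2)" "expectation (\<lambda>\<omega>. (R m j \<omega>)\<^sup>2) \<le> C * j" for m j
    using second_moment[of "{m\<^sup>2+1..m\<^sup>2+j}"] meas sq orth' bound unfolding R_def by auto
  have A_int: "integrable M (A m)" for m
    unfolding A_def[abs_def] using L(1) R(1) by simp
  have A_nonneg: "0 \<le> A m \<omega>" for m \<omega>
    unfolding A_def by (auto intro!: divide_nonneg_nonneg add_nonneg_nonneg sum_nonneg)
  have A_bound: "expectation (A m) \<le> 7 * C * inverse ((real m)\<^sup>2)" for m
  proof (cases "m = 0")
    case True
    then show ?thesis by (simp add: A_def[abs_def])
  next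
    case False
    have "(\<Sum>j\<le>2*m. C * real j) \<le> (\<Sum>j\<le>2*m. C * (2 * real m))"
      using C by (intro sum_mono mult_left_mono) auto
    also have "\<dots> = C * ((2 * real m + 1) * (2 * real m))"
      by (simp add: algebra_simps)
    also have "\<dots> \<le> C * (6 * (real m)\<^sup>2)"
    proof (rule mult_left_mono[OF _ C])
      have "real m \<le> (real m)\<^sup>2"
        using False by (simp add: power2_eq_square)
      then show "(2 * real m + 1) * (2 * real m) \<le> 6 * (real m)\<^sup>2"
        by (simp add: algebra_simps power2_eq_square)
    qed
    finally have R_sum: "(\<Sum>j\<le>2*m. C * real j) \<le> C * (6 * (real m)\<^sup>2)" .
    have "expectation (A m)
        = (expectation (\<lambda>\<omega>. (L m \<omega>)\<^sup>2) + (\<Sum>j\<le>2*m. expectation (\<lambda>\<omega>. (R m j \<omega>)\<^sup>2))) / (real m)^4"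
      unfolding A_def[abs_def] using L(1) R(1) by simp
    also have "\<dots> \<le> (C * (real m)\<^sup>2 + (\<Sum>j\<le>2*m. C * j)) / (real m)^4"
      using L(2) R(2) by (intro divide_right_mono add_mono sum_mono) auto
    also have "\<dots> \<le> (7 * C * (real m)\<^sup>2) / (real m)^4"
      using R_sum by (intro divide_right_mono) auto
    also have "\<dots> = 7 * C * inverse ((real m)\<^sup>2)"
      using False by (simp add: divide_simps power4_eq_xxxx power2_eq_square)
    finally show ?thesis .
  qed
  have "summable (\<lambda>m. 7 * C * inverse ((real m)\<^sup>2))"
    by (intro summable_mult inverse_power_summable) simp
  then have "summable (\<lambda>m. expectation (A m))"
    by (rule summable_comparison_test'[where N = 0])
      (use A_bound A_nonneg in \<open>auto simp: Bochner_Integration.integral_nonneg\<close>)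
  then have "AE \<omega> in M. (\<lambda>m. A m \<omega>) \<longlonglongrightarrow> 0"
    using A_int A_nonneg by (intro AE_tendsto_zero_of_summable_integral)
  then show ?thesis
  proof (rule AE_mp, intro AE_I2 impI)
    fix \<omega> assume lim: "(\<lambda>m. A m \<omega>) \<longlonglongrightarrow> 0"
    have *: "((\<Sum>k=1..n. Z k \<omega>) / real n)\<^sup>2 \<le> 2 * A (floor_sqrt n) \<omega>" if "n \<ge> 1" for n
    proof -
      define m where "m = floor_sqrt n"
      define j where "j = n - m\<^sup>2"
      have m: "m\<^sup>2 \<le> n" "n < (Suc m)\<^sup>2"
        by (simp_all add: m_def Suc_floor_sqrt_power2_gt)
      then have n: "n = m\<^sup>2 + j" and j: "j \<le> 2 * m"
        by (auto simp: j_def power2_eq_square)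
      have m1: "m \<ge> 1"
        using that m by (cases m) auto
      have "(\<Sum>k=1..n. Z k \<omega>) = L m \<omega> + R m j \<omega>"
        unfolding n L_def R_def by (rule sum.ub_add_nat) simp
      then have "(\<Sum>k=1..n. Z k \<omega>)\<^sup>2 \<le> 2 * ((L m \<omega>)\<^sup>2 + (R m j \<omega>)\<^sup>2)"
        using sum_squares_bound[of "L m \<omega>" "R m j \<omega>"] by (simp add: power2_sum)
      also have "(R m j \<omega>)\<^sup>2 \<le> (\<Sum>j\<le>2*m. (R m j \<omega>)\<^sup>2)"
        using j by (intro member_le_sum) auto
      finally have num: "(\<Sum>k=1..n. Z k \<omega>)\<^sup>2 \<le> 2 * ((L m \<omega>)\<^sup>2 + (\<Sum>j\<le>2*m. (R m j \<omega>)\<^sup>2))"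
        by simp
      have "(real m)^4 \<le> (real n)\<^sup>2"
      proof -
        have "(real m)^2 \<le> real n" using m(1) by (metis of_nat_le_iff of_nat_power)
        then have "((real m)^2)^2 \<le> (real n)\<^sup>2" by (intro power_mono) auto
        then show ?thesis by simp
      qed
      then have "((\<Sum>k=1..n. Z k \<omega>) / real n)\<^sup>2 \<le> 2 * ((L m \<omega>)\<^sup>2 + (\<Sum>j\<le>2*m. (R m j \<omega>)\<^sup>2)) / (real m)^4"
        unfolding power_divide using num m1
        by (intro frac_le) (auto intro!: add_nonneg_nonneg sum_nonneg)
      then show ?thesis
        by (simp add: A_def m_def)
    qed
    have "filterlim floor_sqrt at_top sequentially"
      unfolding filterlim_at_top
    proof
      fix K :: nat
      have "K \<le> floor_sqrt n" if "n \<ge> K\<^sup>2" for n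
        using mono_floor_sqrt'[OF that] by simp
      then show "eventually (\<lambda>n. K \<le> floor_sqrt n) sequentially"
        by (auto simp: eventually_sequentially)
    qed
    then have "(\<lambda>n. A (floor_sqrt n) \<omega>) \<longlonglongrightarrow> 0"
      using lim by (rule filterlim_compose[rotated])
    then have "(\<lambda>n. 2 * A (floor_sqrt n) \<omega>) \<longlonglongrightarrow> 0"
      by (rule tendsto_mult_right_zero)
    then have "(\<lambda>n. ((\<Sum>k=1..n. Z k \<omega>) / real n)\<^sup>2) \<longlonglongrightarrow> 0"
      by (rule tendsto_sandwich[OF _ _ tendsto_const, rotated 2])
        (auto intro!: eventually_sequentiallyI[of 1] *[unfolded One_nat_def])
    then show "(\<lambda>n. (\<Sum>k=1..n. Z k \<omega>) / real n) \<longlonglongrightarrow> 0"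
      by simp
  qed
qed

section \<open>Almost sure properties of the noise\<close>

text \<open>
  For every \<open>d > 0\<close> the probabilities of \<open>(V n)\<^sup>2 > d * n\<close> sum to at most the expectation of
  \<open>(V 1)\<^sup>2 / d\<close>, because at most \<open>w\<close> positive integers are smaller than \<open>w\<close>. The first Borel-Cantelli
  lemma then applies.
\<close>
lemma (in prob_space) identically_distributed_sublinear_growth:
  fixes V :: "nat \<Rightarrow> 'a \<Rightarrow> real"
  assumes meas: "\<And>n. n \<ge> 1 \<Longrightarrow> V n \<in> borel_measurable M"
    and ident: "\<And>n. n \<ge> 1 \<Longrightarrow> distr M borel (V n) = distr M borel (V 1)"
    and sq: "integrable M (\<lambda>\<omega>. (V 1 \<omega>)\<^sup>2)"
  shows "AE \<omega> in M. (\<lambda>n. V n \<omega> / sqrt n) \<longlonglongrightarrow> 0"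
proof -
  have count: "(\<Sum>n=1..N. if real n < w then 1 else 0) \<le> w" if "0 \<le> w" for w :: real and N
  proof -
    have "(\<Sum>n=1..N. if real n < w then 1 else 0) \<le> min (real N) w"
      using that by (induction N) (auto simp: min_def split: if_splits)
    then show ?thesis by simp
  qed
  have [measurable]: "V 1 \<in> borel_measurable M" "V (Suc n) \<in> borel_measurable M" for n
    using meas by auto
  have eventually_small: "AE \<omega> in M. \<forall>\<^sub>F n in sequentially. (V (Suc n) \<omega>)\<^sup>2 \<le> d * real (Suc n)"
    if "d > 0" for d :: real
  proof -
    define A where "A n = {\<omega>\<in>space M. d * real (Suc n) < (V (Suc n) \<omega>)\<^sup>2}" for n
    have A[measurable]: "A n \<in> sets M" for n
      unfolding A_def by measurable
    have prob_A: "prob (A n) = expectation (\<lambda>\<omega>. if real (Suc n) < (V 1 \<omega>)\<^sup>2 / d then 1 else 0)" for n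
    proof -
      have "prob (A n) = measure (distr M borel (V (Suc n))) {y. d * real (Suc n) < y\<^sup>2}"
        by (subst measure_distr) (auto simp: A_def vimage_def Int_def conj_commute)
      also have "\<dots> = measure (distr M borel (V 1)) {y. d * real (Suc n) < y\<^sup>2}"
        by (subst ident) auto
      also have "\<dots> = prob {\<omega>\<in>space M. d * real (Suc n) < (V 1 \<omega>)\<^sup>2}"
        by (subst measure_distr) (auto simp: vimage_def Int_def conj_commute)
      also have "\<dots> = expectation (indicator {\<omega>\<in>space M. d * real (Suc n) < (V 1 \<omega>)\<^sup>2})"
        by simp
      also have "\<dots> = expectation (\<lambda>\<omega>. if real (Suc n) < (V 1 \<omega>)\<^sup>2 / d then 1 else 0)"
        using that by (intro Bochner_Integration.integral_cong refl) (auto simp: indicator_def field_simps)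
      finally show ?thesis .
    qed
    have int: "integrable M (\<lambda>\<omega>. if real n < (V 1 \<omega>)\<^sup>2 / d then 1 else 0 :: real)" for n
      by (rule integrable_const_bound[where B = 1]) auto
    have "(\<Sum>n<N. prob (A n)) \<le> expectation (\<lambda>\<omega>. (V 1 \<omega>)\<^sup>2 / d)" for N
    proof -
      have "(\<Sum>n<N. prob (A n)) = (\<Sum>n=1..N. expectation (\<lambda>\<omega>. if real n < (V 1 \<omega>)\<^sup>2 / d then 1 else 0))"
        unfolding prob_A by (rule sum.reindex_bij_witness[of _ "\<lambda>n. n - 1" Suc]) auto
      also have "\<dots> = expectation (\<lambda>\<omega>. \<Sum>n=1..N. if real n < (V 1 \<omega>)\<^sup>2 / d then 1 else 0)"
        by (rule Bochner_Integration.integral_sum[symmetric]) (rule int)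
      also have "\<dots> \<le> expectation (\<lambda>\<omega>. (V 1 \<omega>)\<^sup>2 / d)"
        using sq that by (intro integral_mono count Bochner_Integration.integrable_sum int) auto
      finally show ?thesis .
    qed
    then have "summable (\<lambda>n. prob (A n))"
      by (intro summableI_nonneg_bounded) auto
    then have "AE \<omega> in M. \<forall>\<^sub>F n in sequentially. \<omega> \<in> space M - A n"
      by (intro borel_cantelli_AE1) (auto simp: emeasure_eq_measure)
    then show ?thesis
      by eventually_elim (auto simp: A_def not_less elim: eventually_mono)
  qed
  have "AE \<omega> in M. \<forall>i. \<forall>\<^sub>F n in sequentially. (V (Suc n) \<omega>)\<^sup>2 \<le> inverse (real (Suc i)) * real (Suc n)"
    unfolding AE_all_countable by (intro allI eventually_small) simp
  then show ?thesis
  proof (rule AE_mp, intro AE_I2 impI)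
    fix \<omega> assume small: "\<forall>i. \<forall>\<^sub>F n in sequentially. (V (Suc n) \<omega>)\<^sup>2 \<le> inverse (real (Suc i)) * real (Suc n)"
    have "(\<lambda>n. (V (Suc n) \<omega> / sqrt (Suc n))\<^sup>2) \<longlonglongrightarrow> 0"
    proof (rule tendstoI)
      fix e :: real assume "0 < e"
      then obtain i where i: "inverse (real (Suc i)) < e"
        using reals_Archimedean by blast
      show "\<forall>\<^sub>F n in sequentially. dist ((V (Suc n) \<omega> / sqrt (Suc n))\<^sup>2) 0 < e"
        using small[rule_format, of i]
      proof eventually_elim
        case (elim n)
        then have "(V (Suc n) \<omega>)\<^sup>2 / real (Suc n) \<le> inverse (real (Suc i))"
          by (subst pos_divide_le_eq) auto
        moreover have "(V (Suc n) \<omega> / sqrt (Suc n))\<^sup>2 = (V (Suc n) \<omega>)\<^sup>2 / real (Suc n)"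
          by (simp add: power_divide)
        ultimately show ?case using i by (simp add: dist_real_def)
      qed
    qed
    then have "(\<lambda>n. V (Suc n) \<omega> / sqrt (Suc n)) \<longlonglongrightarrow> 0"
      by simp
    then show "(\<lambda>n. V n \<omega> / sqrt n) \<longlonglongrightarrow> 0"
      by (rule LIMSEQ_imp_Suc)
  qed
qed

text \<open>
  Allowing exponents up to two lets one formula cover products in which indices coincide, such as
  \<open>V i * V k * V k * V l\<close>.
\<close>
lemma (in prob_space) independent_monomials:
  fixes V :: "nat \<Rightarrow> 'a \<Rightarrow> real"
  assumes indep: "indep_vars (\<lambda>_. borel) V J" and J: "finite I" "I \<subseteq> J"
    and sq: "\<And>n. n \<in> J \<Longrightarrow> integrable M (\<lambda>\<omega>. (V n \<omega>)\<^sup>2)" and d: "\<And>i. i \<in> I \<Longrightarrow> d i \<le> 2"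
  shows "integrable M (\<lambda>\<omega>. \<Prod>i\<in>I. V i \<omega> ^ d i)"
    and "expectation (\<lambda>\<omega>. \<Prod>i\<in>I. V i \<omega> ^ d i) = (\<Prod>i\<in>I. expectation (\<lambda>\<omega>. V i \<omega> ^ d i))"
proof -
  have ind: "indep_vars (\<lambda>_. borel) (\<lambda>i \<omega>. V i \<omega> ^ d i) I"
    using indep_vars_subset[OF indep J(2)] by (rule indep_vars_compose2) auto
  have int: "integrable M (\<lambda>\<omega>. V i \<omega> ^ d i)" if i: "i \<in> I" for i
  proof -
    have [measurable]: "V i \<in> borel_measurable M"
      using indep J i by (auto simp: indep_vars_def2)
    have sq_i: "integrable M (\<lambda>\<omega>. (V i \<omega>)\<^sup>2)" using sq J i by auto
    consider "d i = 0" | "d i = 1" | "d i = 2" using d[OF i] by linarith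
    then show ?thesis
    proof cases
      case 2
      then show ?thesis using square_integrable_imp_integrable[OF _ sq_i] by simp
    qed (use sq_i in auto)
  qed
  show "integrable M (\<lambda>\<omega>. \<Prod>i\<in>I. V i \<omega> ^ d i)"
    by (rule indep_vars_integrable[OF J(1) ind int])
  show "expectation (\<lambda>\<omega>. \<Prod>i\<in>I. V i \<omega> ^ d i) = (\<Prod>i\<in>I. expectation (\<lambda>\<omega>. V i \<omega> ^ d i))"
    by (rule indep_vars_lebesgue_integral[OF J(1) ind int])
qed

text \<open>
  The products \<open>V k * V (k - j)\<close> are not independent, but they are orthogonal with equal second
  moments: for \<open>i < k\<close> the factor \<open>V k\<close> occurs exactly once in the product of those at \<open>i\<close> and \<open>k\<close>, and
  it is centred.
\<close>
lemma (in prob_space) lagged_products_average_vanish: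
  fixes V :: "nat \<Rightarrow> 'a \<Rightarrow> real"
  assumes indep: "indep_vars (\<lambda>_. borel) V {1..}"
    and sq: "\<And>n. n \<ge> 1 \<Longrightarrow> integrable M (\<lambda>\<omega>. (V n \<omega>)\<^sup>2)"
    and mean: "\<And>n. n \<ge> 1 \<Longrightarrow> expectation (V n) = 0"
    and var: "\<And>n. n \<ge> 1 \<Longrightarrow> expectation (\<lambda>\<omega>. (V n \<omega>)\<^sup>2) = s"
    and "j \<ge> 1"
  shows "AE \<omega> in M. (\<lambda>n. (\<Sum>k\<in>{j<..n}. V k \<omega> * V (k - j) \<omega>) / n) \<longlonglongrightarrow> 0"
proof -
  have meas[measurable]: "V n \<in> borel_measurable M" if "n \<ge> 1" for n
    using indep that by (auto simp: indep_vars_def2)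
  define Z where "Z k \<omega> = (if j < k then V k \<omega> * V (k - j) \<omega> else 0)" for k \<omega>
  have sq_prod: "integrable M (\<lambda>\<omega>. (V k \<omega> * V (k - j) \<omega>)\<^sup>2)"
    "expectation (\<lambda>\<omega>. (V k \<omega> * V (k - j) \<omega>)\<^sup>2) = s * s" if "j < k" for k
  proof -
    have "(\<Prod>i\<in>{k, k - j}. V i \<omega> ^ 2) = (V k \<omega> * V (k - j) \<omega>)\<^sup>2" for \<omega>
      using that \<open>j \<ge> 1\<close> by (simp add: power_mult_distrib)
    with independent_monomials[OF indep, of "{k, k - j}" "\<lambda>_. 2"] sq that \<open>j \<ge> 1\<close>
    show "integrable M (\<lambda>\<omega>. (V k \<omega> * V (k - j) \<omega>)\<^sup>2)"
      "expectation (\<lambda>\<omega>. (V k \<omega> * V (k - j) \<omega>)\<^sup>2) = s * s"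
      by (simp_all add: var)
  qed
  have "AE \<omega> in M. (\<lambda>n. (\<Sum>k=1..n. Z k \<omega>) / real n) \<longlonglongrightarrow> 0"
  proof (rule strong_law_orthogonal)
    fix k :: nat assume "k \<ge> 1"
    show "Z k \<in> borel_measurable M"
      unfolding Z_def[abs_def] by (cases "j < k") (auto intro!: borel_measurable_times meas)
    show "integrable M (\<lambda>\<omega>. (Z k \<omega>)\<^sup>2)"
      by (cases "j < k") (simp_all add: Z_def sq_prod)
    show "expectation (\<lambda>\<omega>. (Z k \<omega>)\<^sup>2) \<le> s * s"
      by (cases "j < k") (simp_all add: Z_def sq_prod)
  next
    fix i k :: nat assume "1 \<le> i" "i < k"
    show "expectation (\<lambda>\<omega>. Z i \<omega> * Z k \<omega>) = 0"
    proof (cases "j < i")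
      case False
      then show ?thesis by (simp add: Z_def)
    next
      case True
      define I where "I = {i, i - j, k, k - j}"
      \<comment> \<open>The multiplicity of each index among the four factors, two of which may coincide.\<close>
      define d :: "nat \<Rightarrow> nat" where
        "d l = of_bool (l = i) + of_bool (l = i - j) + of_bool (l = k) + of_bool (l = k - j)" for l
      have I: "finite I" "I \<subseteq> {1..}" "k \<in> I"
        using True \<open>i < k\<close> by (auto simp: I_def)
      have mem: "i \<in> I" "i - j \<in> I" "k - j \<in> I"
        by (auto simp: I_def)
      have single: "(\<Prod>l\<in>I. V l \<omega> ^ of_bool (l = m)) = V m \<omega>" if "m \<in> I" for m \<omega>
      proof -
        have "(\<Prod>l\<in>I. V l \<omega> ^ of_bool (l = m)) = (\<Prod>l\<in>I. if l = m then V l \<omega> else 1)"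
          by (intro prod.cong) auto
        then show ?thesis using that I(1) by simp
      qed
      have "(\<Prod>l\<in>I. V l \<omega> ^ d l) = Z i \<omega> * Z k \<omega>" for \<omega>
      proof -
        have "(\<Prod>l\<in>I. V l \<omega> ^ d l) = V i \<omega> * V (i - j) \<omega> * V k \<omega> * V (k - j) \<omega>"
          unfolding d_def power_add prod.distrib by (simp only: single mem I(3))
        then show ?thesis using True \<open>i < k\<close> by (simp add: Z_def)
      qed
      moreover have "expectation (\<lambda>\<omega>. \<Prod>l\<in>I. V l \<omega> ^ d l) = (\<Prod>l\<in>I. expectation (\<lambda>\<omega>. V l \<omega> ^ d l))"
      proof (rule independent_monomials(2)[OF indep I(1,2)])
        show "d l \<le> 2" if "l \<in> I" for l
          using \<open>i < k\<close> \<open>j \<ge> 1\<close> True by (auto simp: d_def of_bool_def)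
      qed (use sq in auto)
      moreover have "d k = 1"
        using \<open>i < k\<close> \<open>j \<ge> 1\<close> True by (auto simp: d_def of_bool_def)
      then have "(\<Prod>l\<in>I. expectation (\<lambda>\<omega>. V l \<omega> ^ d l)) = 0"
        using I \<open>i < k\<close> by (intro prod_zero bexI[of _ k]) (auto simp: mean)
      ultimately show ?thesis by simp
    qed
  qed
  moreover have "(\<Sum>k=1..n. Z k \<omega>) = (\<Sum>k\<in>{j<..n}. V k \<omega> * V (k - j) \<omega>)" for n \<omega>
    unfolding Z_def by (rule sum.mono_neutral_cong_right) auto
  ultimately show ?thesis by simp
qed

text \<open>
  Replacing \<open>y\<^sup>2\<close> by \<open>min (y\<^sup>2) 1\<close> only lowers the sum and yields bounded variables, to which the
  strong law for orthogonal variables applies. Their common mean is positive because a square with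
  truncation almost surely zero is itself almost surely zero.
\<close>
lemma (in prob_space) sum_of_squares_linear_growth:
  fixes V :: "nat \<Rightarrow> 'a \<Rightarrow> real"
  assumes indep: "indep_vars (\<lambda>_. borel) V {1..}"
    and ident: "\<And>n. n \<ge> 1 \<Longrightarrow> distr M borel (V n) = distr M borel (V 1)"
    and nonzero: "expectation (\<lambda>\<omega>. (V 1 \<omega>)\<^sup>2) \<noteq> 0"
  obtains c where "c > 0"
    and "AE \<omega> in M. \<forall>\<^sub>F n in sequentially. c * real n \<le> (\<Sum>k=1..n. (V k \<omega>)\<^sup>2)"
proof -
  have meas: "V n \<in> borel_measurable M" if "n \<ge> 1" for n
    using indep that by (auto simp: indep_vars_def2)
  define g :: "real \<Rightarrow> real" where "g y = min (y\<^sup>2) 1" for y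
  have [measurable]: "g \<in> borel_measurable borel"
    unfolding g_def[abs_def] by measurable
  have g: "0 \<le> g y" "g y \<le> 1" "g y \<le> y\<^sup>2" for y
    by (auto simp: g_def)
  have g_meas: "(\<lambda>\<omega>. g (V n \<omega>)) \<in> borel_measurable M" if "n \<ge> 1" for n
    using meas[OF that] by measurable
  define \<mu> where "\<mu> = expectation (\<lambda>\<omega>. g (V 1 \<omega>))"
  have g_int: "integrable M (\<lambda>\<omega>. g (V n \<omega>))" if "n \<ge> 1" for n
    using g g_meas[OF that] by (intro integrable_const_bound[where B = 1]) auto
  have g_mean: "expectation (\<lambda>\<omega>. g (V n \<omega>)) = \<mu>" if "n \<ge> 1" for n
  proof -
    have "expectation (\<lambda>\<omega>. g (V n \<omega>)) = integral\<^sup>L (distr M borel (V n)) g"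
      using meas[OF that] by (simp add: integral_distr)
    also have "\<dots> = integral\<^sup>L (distr M borel (V 1)) g"
      by (simp only: ident[OF that])
    also have "\<dots> = \<mu>"
      using meas[of 1] by (simp add: integral_distr \<mu>_def)
    finally show ?thesis .
  qed
  have "\<mu> \<noteq> 0"
  proof
    assume "\<mu> = 0"
    then have "AE \<omega> in M. g (V 1 \<omega>) = 0"
      using g g_int[of 1] by (simp add: \<mu>_def integral_nonneg_eq_0_iff_AE)
    then have "AE \<omega> in M. (V 1 \<omega>)\<^sup>2 = 0"
      by eventually_elim (auto simp: g_def min_def split: if_splits)
    then have "expectation (\<lambda>\<omega>. (V 1 \<omega>)\<^sup>2) = expectation (\<lambda>\<omega>. 0)"
      using meas[of 1] by (intro integral_cong_AE) auto
    then show False using nonzero by simp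
  qed
  moreover have "0 \<le> \<mu>" unfolding \<mu>_def using g by simp
  ultimately have "\<mu> > 0" by simp
  have \<mu>_le: "\<mu> \<le> 1"
  proof -
    have "\<mu> \<le> expectation (\<lambda>\<omega>. 1)"
      unfolding \<mu>_def by (intro integral_mono g_int g) auto
    then show ?thesis by (simp add: prob_space)
  qed
  have centred: "\<bar>g y - \<mu>\<bar> \<le> 1" for y
    using g(1,2)[of y] \<open>0 \<le> \<mu>\<close> \<mu>_le by linarith
  have "AE \<omega> in M. (\<lambda>n. (\<Sum>k=1..n. g (V k \<omega>) - \<mu>) / real n) \<longlonglongrightarrow> 0"
  proof (rule strong_law_orthogonal)
    fix k :: nat assume k: "k \<ge> 1"
    show "(\<lambda>\<omega>. g (V k \<omega>) - \<mu>) \<in> borel_measurable M"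
      using g_meas[OF k] by simp
    have sq_le: "(g y - \<mu>)\<^sup>2 \<le> 1" for y
      using centred[of y] by (simp add: abs_square_le_1)
    show int: "integrable M (\<lambda>\<omega>. (g (V k \<omega>) - \<mu>)\<^sup>2)"
      using g_meas[OF k] sq_le by (intro integrable_const_bound[where B = 1]) auto
    have "expectation (\<lambda>\<omega>. (g (V k \<omega>) - \<mu>)\<^sup>2) \<le> expectation (\<lambda>\<omega>. 1)"
      by (intro integral_mono int sq_le) auto
    then show "expectation (\<lambda>\<omega>. (g (V k \<omega>) - \<mu>)\<^sup>2) \<le> 1"
      by (simp add: prob_space)
  next
    fix i k :: nat assume "1 \<le> i" "i < k"
    have ind: "indep_vars (\<lambda>_. borel) (\<lambda>l \<omega>. g (V l \<omega>) - \<mu>) {i, k}"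
      using indep_vars_subset[OF indep, of "{i, k}"] \<open>1 \<le> i\<close> \<open>i < k\<close>
      by (intro indep_vars_compose2[where Y = "\<lambda>_ y. g y - \<mu>" and M' = "\<lambda>_. borel"]) auto
    have "expectation (\<lambda>\<omega>. \<Prod>l\<in>{i, k}. g (V l \<omega>) - \<mu>) = (\<Prod>l\<in>{i, k}. expectation (\<lambda>\<omega>. g (V l \<omega>) - \<mu>))"
      using \<open>1 \<le> i\<close> \<open>i < k\<close> g_int by (intro indep_vars_lebesgue_integral ind) auto
    moreover have "expectation (\<lambda>\<omega>. g (V i \<omega>) - \<mu>) = 0"
      using g_int[OF \<open>1 \<le> i\<close>] g_mean[OF \<open>1 \<le> i\<close>] by (simp add: prob_space)
    ultimately show "expectation (\<lambda>\<omega>. (g (V i \<omega>) - \<mu>) * (g (V k \<omega>) - \<mu>)) = 0"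
      using \<open>i < k\<close> by simp
  qed
  then have "AE \<omega> in M. \<forall>\<^sub>F n in sequentially. \<mu> / 2 * real n \<le> (\<Sum>k=1..n. (V k \<omega>)\<^sup>2)"
  proof (rule AE_mp, intro AE_I2 impI)
    fix \<omega> assume lim: "(\<lambda>n. (\<Sum>k=1..n. g (V k \<omega>) - \<mu>) / real n) \<longlonglongrightarrow> 0"
    have "\<forall>\<^sub>F n in sequentially. - (\<mu> / 2) < (\<Sum>k=1..n. g (V k \<omega>) - \<mu>) / real n"
      using lim \<open>\<mu> > 0\<close> by (intro order_tendstoD) auto
    then show "\<forall>\<^sub>F n in sequentially. \<mu> / 2 * real n \<le> (\<Sum>k=1..n. (V k \<omega>)\<^sup>2)"
      using eventually_gt_at_top[of 0]
    proof eventually_elim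
      case (elim n)
      then have "- (\<mu> / 2) * real n < (\<Sum>k=1..n. g (V k \<omega>) - \<mu>)"
        by (subst (asm) pos_less_divide_eq) auto
      also have "\<dots> = (\<Sum>k=1..n. g (V k \<omega>)) - \<mu> * n"
        by (simp add: sum_subtractf)
      also have "\<dots> \<le> (\<Sum>k=1..n. (V k \<omega>)\<^sup>2) - \<mu> * n"
        by (intro diff_right_mono sum_mono g)
      finally show ?case by (simp add: algebra_simps)
    qed
  qed
  with \<open>\<mu> > 0\<close> show thesis
    by (intro that[of "\<mu> / 2"]) auto
qed

section \<open>Convergence of the Durbin-Watson statistic\<close>

theorem theorem4p1:
  fixes M :: "'a measure"
    and \<theta> \<rho> \<sigma> :: real
    and V X \<epsilon> :: "nat \<Rightarrow> 'a \<Rightarrow> real"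
  assumes "prob_space M"
    and "\<bar>\<theta>\<bar> < 1" and "\<bar>\<rho>\<bar> < 1"
    and "prob_space.indep_vars M (\<lambda>_. borel) V {1..}"
    and "\<And>n. n \<ge> 1 \<Longrightarrow> distr M borel (V n) = distr M borel (V 1)"
    and "\<And>n. n \<ge> 1 \<Longrightarrow> integrable M (\<lambda>\<omega>. (V n \<omega>)\<^sup>2)"
    and "\<And>n. n \<ge> 1 \<Longrightarrow> prob_space.expectation M (V n) = 0"
    and "\<And>n. n \<ge> 1 \<Longrightarrow> prob_space.variance M (V n) = \<sigma>\<^sup>2"
    and "\<sigma>\<^sup>2 > 0"
    and "X 0 \<in> borel_measurable M" and "\<epsilon> 0 \<in> borel_measurable M"
    and "\<And>n \<omega>. n \<ge> 1 \<Longrightarrow> \<omega> \<in> space M \<Longrightarrow> X n \<omega> = \<theta> * X (n - 1) \<omega> + \<epsilon> n \<omega>"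
    and "\<And>n \<omega>. n \<ge> 1 \<Longrightarrow> \<omega> \<in> space M \<Longrightarrow> \<epsilon> n \<omega> = \<rho> * \<epsilon> (n - 1) \<omega> + V n \<omega>"
  shows "AE \<omega> in M. (\<lambda>n. durbin_watson (\<lambda>k. X k \<omega>) n) \<longlonglongrightarrow> D_star \<theta> \<rho>"
proof -
  interpret prob_space M by fact
  note \<theta> = assms(2) and \<rho> = assms(3) and indep = assms(4) and ident = assms(5)
    and sq = assms(6) and mean = assms(7) and recX = assms(12) and rec\<epsilon> = assms(13)
  have meas: "V n \<in> borel_measurable M" if "n \<ge> 1" for n
    using indep that by (auto simp: indep_vars_def2)
  have second: "expectation (\<lambda>\<omega>. (V n \<omega>)\<^sup>2) = \<sigma>\<^sup>2" if "n \<ge> 1" for n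
    using assms(8)[OF that] by (simp add: mean[OF that])
  have "expectation (\<lambda>\<omega>. (V 1 \<omega>)\<^sup>2) \<noteq> 0"
    using second[of 1] assms(9) by simp
  from sum_of_squares_linear_growth[OF indep ident this] obtain c where "c > 0"
    and growth: "AE \<omega> in M. \<forall>\<^sub>F n in sequentially. c * real n \<le> (\<Sum>k=1..n. (V k \<omega>)\<^sup>2)"
    by auto
  have "AE \<omega> in M. (\<lambda>n. (\<Sum>k\<in>{Suc j<..n}. V k \<omega> * V (k - Suc j) \<omega>) / n) \<longlonglongrightarrow> 0" for j
    by (rule lagged_products_average_vanish[OF indep sq mean second]) auto
  then have lagged: "AE \<omega> in M. \<forall>j. (\<lambda>n. (\<Sum>k\<in>{Suc j<..n}. V k \<omega> * V (k - Suc j) \<omega>) / n) \<longlonglongrightarrow> 0"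
    by (simp add: AE_all_countable)
  have "AE \<omega> in M. (\<lambda>n. V n \<omega> / sqrt n) \<longlonglongrightarrow> 0"
    using meas ident sq[OF order_refl] by (rule identically_distributed_sublinear_growth)
  from AE_space growth lagged this show ?thesis
  proof eventually_elim
    case (elim \<omega>)
    note energy = elim(2) and lag = elim(3) and small = elim(4)
    show "durbin_watson (\<lambda>k. X k \<omega>) \<longlonglongrightarrow> D_star \<theta> \<rho>"
    proof (rule durbin_watson_path_limit[OF \<theta> \<rho> _ _ _ small \<open>c > 0\<close> energy])
      show "X k \<omega> = \<theta> * X (k - 1) \<omega> + \<epsilon> k \<omega>" if "k \<ge> 1" for k
        using that elim(1) by (rule recX)
      show "\<epsilon> k \<omega> = \<rho> * \<epsilon> (k - 1) \<omega> + V k \<omega>" if "k \<ge> 1" for k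
        using that elim(1) by (rule rec\<epsilon>)
      show "(\<lambda>n. (\<Sum>k\<in>{j<..n}. V k \<omega> * V (k - j) \<omega>) / n) \<longlonglongrightarrow> 0" if "j \<ge> 1" for j
        using lag[rule_format, of "j - 1"] that by simp
    qed
  qed
qed

end
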